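(* Assume (AD) and (AR) from the context, let $(x_n,w_n,u_n)_{n\in\mathbb{N}}$ be generated by the (3-D) method with $y=\bar y$, and suppose that $(\lambda_n)_{n\in\mathbb{N}}\in\ell^{\frac{1}{p-1}}(\mathbb{N})$. Let $x^\dagger$ be the solution of the problem $$(P)\qquad \text{minimize } \Big\{R(x)\ \Big|\ x\in\operatorname{argmin}_{x'\in X} D(Ax';\bar y)\Big\},$$ and consider the dual problem $$(D)\qquad \text{minimize}_{u\in Y}\ R^*(-A^*u)+\langle \bar y,u\rangle .$$ Then the following three properties are equivalent: (i) $\partial R(x^\dagger)\cap \operatorname{Im}A^*\neq\emptyset$; (ii) the dual problem $(D)$ admits a solution; (iii) $(u_n)_{n\in\mathbb{N}}$ is a bounded sequence. If one of these properties is satisfied, then the following hold: 1. $(u_n)_{n\in\mathbb{N}}$ converges weakly to a solution of $(D)$. 2. $(x_n)_{n\in\mathbb{N}}$ converges strongly to $x^\dagger$, with $\|x_n-x^\dagger\|=o(n^{-1/2})$. 3. Let $u^\dagger$ be any solution of $(D)$ and let $N\in\mathbb{N}$ be such that $\|u^\dagger\|\lambda_N\in\operatorname{int}\operatorname{dom}\bar m^*$. Then, for every integer $n>N$, $$\|x_n-x^\dagger\|\le\frac{C}{\sqrt{n-N}},\qquad\text{where } C^2=\frac{1}{\tau\sigma_R}\|u_N-u^\dagger\|^2+\sum_{n=N}^{+\infty}\frac{2}{\sigma_R\lambda_n}\,\bar m^*(\|u^\dagger\|\lambda_n).$$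
   Context: Notation. $\Gamma_0(H)$ is the set of proper, convex, lower semicontinuous functions from a Hilbert space $H$ to $]-\infty,+\infty]$; $f^*$ is the Fenchel conjugate of $f$; $f\in\Gamma_0(H)$ is $\sigma$-strongly convex ($\sigma>0$) if $f-\frac{\sigma}{2}\|\cdot\|^2\in\Gamma_0(H)$; $(f\# g)(x)=\inf_{x'}\{f(x')+g(x-x')\}$ is the infimal convolution; $\operatorname{prox}_f(x)=\operatorname{argmin}_{x'}\{f(x')+\frac12\|x'-x\|^2\}$. A function is coercive if it tends to $+\infty$ as $\|x\|\to+\infty$. Conditioning. Let $f\in\Gamma_0(H)$ have a unique minimizer $x_0$. A conditioning modulus for $f$ is a nonnegative even function $m\in\Gamma_0(\mathbb{R})$ such that $m(t)=0\Rightarrow t=0$ and $m(\|x-x_0\|)\le f(x)-f(x_0)$ for all $x\in H$. For $p\in[1,+\infty[$, $f$ is $p$-well conditioned with conditioning modulus $m$ if moreover there exist $\varepsilon,\gamma>0$ with $m(t)\ge\frac{\gamma}{p}|t|^p$ for all $t\in]-\varepsilon,\varepsilon[$. Setting. $X,Y$ are Hilbert spaces, $A:X\to Y$ is a bounded linear operator, $\bar y\in Y$, and there exists $\bar x\in X$ with $A\bar x=\bar y$. Assumption (AD). (AD1) $D:Y\times Y\to[0,+\infty]$ and, for all $(u,y)\in Y^2$, $D(u;y)=0\iff u=y$. (AD2) For every $y\in Y$, $D_y:=D(\cdot;y)$ decomposes as $D_y=\psi_y\#\phi_y$, where $\phi_y\in\Gamma_0(Y)$ and $\psi_y=J_y+\frac{\sigma_\psi}{2}\|\cdot\|^2$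 for some $J_y\in\Gamma_0(Y)$ and some $\sigma_\psi>0$ (independent of $y$). (AD3) $D(\cdot;\bar y)$ is coercive and $p$-well conditioned for some $p\in[1,+\infty[$, with conditioning modulus $\bar m$. Assumption (AR). (AR1) $R\in\Gamma_0(X)$ is $\sigma_R$-strongly convex with $\sigma_R>0$. (AR2) $\bar x\in\operatorname{dom}R$. (3-D) method with datum $y\in Y$. Let $(\lambda_n)_{n\in\mathbb{N}}$ be a sequence in $]0,+\infty[$ decreasing (nonincreasing) to $0$, $L=\|A\|^2/\sigma_R+\lambda_0/\sigma_\psi$, $\tau\in]0,1/L]$, $u_0\in Y$, and for all $n\in\mathbb{N}$ $$x_n=\nabla R^*(-A^*u_n),\quad w_{n+1}=u_n+\tau Ax_n-\tau\nabla\psi_y^*(\lambda_nu_n),\quad u_{n+1}=w_{n+1}-\tau\operatorname{prox}_{(\tau\lambda_n)^{-1}\phi_y}(\tau^{-1}w_{n+1}).$$ Convention. $(\lambda_n)\in\ell^{1/(p-1)}(\mathbb{N})$ means $\sum_n\lambda_n^{1/(p-1)}<+\infty$ if $p>1$; if $p=1$, $1/0$ stands for $\infty$ and the condition is automatically satisfied. *)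

theory Defs
  imports "HOL-Analysis.Analysis" "HOL-Library.Landau_Symbols"
begin

definition edom :: "('a \<Rightarrow> ereal) \<Rightarrow> 'a set" where
  "edom f = {x. f x < \<infinity>}"

definition proper_fun :: "('a \<Rightarrow> ereal) \<Rightarrow> bool" where
  "proper_fun f \<longleftrightarrow> (\<forall>x. f x \<noteq> -\<infinity>) \<and> edom f \<noteq> {}"

definition convex_fun :: "('a::real_vector \<Rightarrow> ereal) \<Rightarrow> bool" where
  "convex_fun f \<longleftrightarrow> (\<forall>x y t. 0 < t \<and> t < 1 \<longrightarrow>
     f ((1 - t) *\<^sub>R x + t *\<^sub>R y) \<le> ereal (1 - t) * f x + ereal t * f y)"

definition lsc_fun :: "('a::topological_space \<Rightarrow> ereal) \<Rightarrow> bool" where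
  "lsc_fun f \<longleftrightarrow> (\<forall>x. f x \<le> Liminf (at x) f)"

definition Gamma0 :: "('a::real_normed_vector \<Rightarrow> ereal) set" where
  "Gamma0 = {f. proper_fun f \<and> convex_fun f \<and> lsc_fun f}"

definition strongly_convex :: "real \<Rightarrow> ('a::real_normed_vector \<Rightarrow> ereal) \<Rightarrow> bool" where
  "strongly_convex \<sigma> f \<longleftrightarrow>
     0 < \<sigma> \<and> f \<in> Gamma0 \<and> (\<lambda>x. f x - ereal (\<sigma> / 2 * (norm x)\<^sup>2)) \<in> Gamma0"

definition conj_fun :: "('a::real_inner \<Rightarrow> ereal) \<Rightarrow> 'a \<Rightarrow> ereal" where
  "conj_fun f u = (SUP x. ereal (x \<bullet> u) - f x)"

definition inf_conv :: "('a::ab_group_add \<Rightarrow> ereal) \<Rightarrow> ('a \<Rightarrow> ereal) \<Rightarrow> 'a \<Rightarrow> ereal" where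
  "inf_conv f g x = (INF x'. f x' + g (x - x'))"

definition argmin_set :: "('a \<Rightarrow> ereal) \<Rightarrow> 'a set" where
  "argmin_set f = {x. is_arg_min f (\<lambda>_. True) x}"

(* Only meaningful where the minimizer exists and is unique, as for f in Gamma0
   on a Hilbert space. *)
definition prox :: "('a::real_normed_vector \<Rightarrow> ereal) \<Rightarrow> 'a \<Rightarrow> 'a" where
  "prox f x = arg_min (\<lambda>x'. f x' + ereal (1 / 2 * (norm (x' - x))\<^sup>2)) (\<lambda>_. True)"

definition subdiff :: "('a::real_inner \<Rightarrow> ereal) \<Rightarrow> 'a \<Rightarrow> 'a set" where
  "subdiff f x = {v. \<forall>y. f x + ereal ((y - x) \<bullet> v) \<le> f y}"

(* Frechet gradient of an extended-real-valued function that is finite near x;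
   an unspecified value where f is not differentiable. *)
definition grad :: "('a::real_inner \<Rightarrow> ereal) \<Rightarrow> 'a \<Rightarrow> 'a" where
  "grad f x = (THE g. (\<forall>\<^sub>F z in nhds x. \<bar>f z\<bar> \<noteq> \<infinity>) \<and>
     GDERIV (\<lambda>z. real_of_ereal (f z)) x :> g)"

definition coercive :: "('a::real_normed_vector \<Rightarrow> ereal) \<Rightarrow> bool" where
  "coercive f \<longleftrightarrow> (f \<longlongrightarrow> \<infinity>) at_infinity"

definition cond_modulus :: "('a::real_normed_vector \<Rightarrow> ereal) \<Rightarrow> (real \<Rightarrow> ereal) \<Rightarrow> bool" where
  "cond_modulus f m \<longleftrightarrow>
     f \<in> Gamma0 \<and> m \<in> Gamma0 \<and> (\<forall>t. 0 \<le> m t) \<and> (\<forall>t. m (- t) = m t) \<and>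
     (\<forall>t. m t = 0 \<longrightarrow> t = 0) \<and>
     (\<exists>x0. argmin_set f = {x0} \<and> (\<forall>x. m (norm (x - x0)) \<le> f x - f x0))"

definition well_conditioned ::
    "real \<Rightarrow> ('a::real_normed_vector \<Rightarrow> ereal) \<Rightarrow> (real \<Rightarrow> ereal) \<Rightarrow> bool" where
  "well_conditioned p f m \<longleftrightarrow> 1 \<le> p \<and> cond_modulus f m \<and>
     (\<exists>\<epsilon>>0. \<exists>\<gamma>>0. \<forall>t\<in>{-\<epsilon><..<\<epsilon>}. ereal (\<gamma> / p * \<bar>t\<bar> powr p) \<le> m t)"

definition weakly_tendsto :: "(nat \<Rightarrow> 'a::real_inner) \<Rightarrow> 'a \<Rightarrow> bool" where
  "weakly_tendsto u l \<longleftrightarrow> (\<forall>z. (\<lambda>n. u n \<bullet> z) \<longlonglongrightarrow> l \<bullet> z)"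

definition dual_objective ::
    "('a::real_inner \<Rightarrow> ereal) \<Rightarrow> ('a \<Rightarrow> 'b::real_inner) \<Rightarrow> 'b \<Rightarrow> 'b \<Rightarrow> ereal" where
  "dual_objective R A y u = conj_fun R (- adjoint A u) + ereal (y \<bullet> u)"

end

theory Submission
  imports Defs
begin

text \<open>The iteration is a forward-backward method on the dual side whose objective moves with $n$. Write
$D^*$ for the conjugate of $D(\cdot;\bar y)$ and put
$d_n(u) = R^*(-A^*u) + \lambda_n^{-1} D^*(\lambda_n u)$ and $d(u) = R^*(-A^*u) + \langle \bar y,u\rangle$,
the objective of the dual problem. Conjugation turns the infimal convolution $\psi \# \phi$ into
$\psi^* + \phi^*$. Strong convexity of $R$ and $\psi$ makes $R^*(-A^*\cdot)$ and $\psi^*$ differentiable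
with quadratic upper bounds, so these two terms are treated explicitly, and the proximal point of
$\phi$ in the algorithm is, by Moreau's decomposition, an implicit step on
$\lambda_n^{-1}\phi^*(\lambda_n\cdot)$.

Since $D \ge 0$ vanishes at $\bar y$, one has $d \le d_n$ and $d_{n+1} \le d_n$. Conditioning bounds
the gap from above: $d_n(z) \le d(z) + E_z(n)$ with
$E_z(n) = \lambda_n^{-1}\bar m^*(\lambda_n\|z\|)$, which is of order $\lambda_n^{1/(p-1)}$ and hence
summable (it vanishes for large $n$ if $p = 1$). With $v_n = d_n(u_{n+1})$, the forward-backward
inequality therefore reads, for every $z$ and all large $n$,
\[ v_n + \frac{1}{2\tau}\|u_{n+1}-z\|^2 \le d(z) + \frac{1}{2\tau}\|u_n-z\|^2 + E_z(n), \]
where $v_n$ is nonincreasing and $d(u_{n+1}) \le v_n$. All assertions about $(u_n)$ follow from it.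
Summation gives $v_n \to \inf d$, and for a dual solution $z$ the summability and monotonicity of
$v_n - d(z) \ge 0$ give $v_n - d(z) = o(1/n)$ together with the explicit constant. A dual solution
also makes $\|u_n-z\|^2$ converge, so $(u_n)$ is bounded and Opial's argument yields the weak limit.
Conversely, a bounded sequence has a point in the closed convex hull of all its tails; as $d$ is
convex, its value there is at most $\lim v_n = \inf d$, so a dual solution exists.

The primal side enters through two facts. The gradient of $d$ at $u$ is $\bar y - A x(u)$ with
$x(u) = \nabla R^*(-A^*u)$, so $u$ solves the dual problem iff $x(u)$ is feasible, in which case
$x(u) = x^\dagger$ and $-A^*u \in \partial R(x^\dagger)$. And strong convexity of $R$ gives
$\frac{\sigma_R}{2}\|x_n-x^\dagger\|^2 \le d(u_n) - \min d$, which transfers the rate to $(x_n)$.\<close>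

section \<open>Proximal points of convex lower semicontinuous functions\<close>

lemma lsc_fun_ball:
  fixes f :: "'a::metric_space \<Rightarrow> ereal"
  assumes "lsc_fun f" "c < f x"
  obtains r where "0 < r" "\<And>z. dist z x < r \<Longrightarrow> c < f z"
proof -
  have "eventually (\<lambda>z. c < f z) (at x)"
    using assms unfolding lsc_fun_def le_Liminf_iff by blast
  then obtain r where "0 < r" and r: "\<And>z. z \<noteq> x \<Longrightarrow> dist z x < r \<Longrightarrow> c < f z"
    unfolding eventually_at by auto
  then show ?thesis using that assms(2) by metis
qed

lemma Gamma0_D:
  assumes "J \<in> Gamma0"
  shows "J x \<noteq> -\<infinity>" "\<exists>x j. J x = ereal j" "lsc_fun J"
    "\<And>x y t. 0 < t \<Longrightarrow> t < 1 \<Longrightarrow> J ((1 - t) *\<^sub>R x + t *\<^sub>R y) \<le> ereal (1 - t) * J x + ereal t * J y"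
proof -
  have p: "proper_fun J" and c: "convex_fun J" and l: "lsc_fun J"
    using assms by (auto simp: Gamma0_def)
  show "J x \<noteq> -\<infinity>" "lsc_fun J" using p l by (auto simp: proper_fun_def)
  obtain y where "J y < \<infinity>" "J y \<noteq> -\<infinity>" using p by (auto simp: proper_fun_def edom_def)
  then show "\<exists>x j. J x = ereal j" by (cases "J y") auto
  show "\<And>x y t. 0 < t \<Longrightarrow> t < 1 \<Longrightarrow> J ((1 - t) *\<^sub>R x + t *\<^sub>R y) \<le> ereal (1 - t) * J x + ereal t * J y"
    using c by (auto simp: convex_fun_def)
qed

lemma Gamma0_convex_real:
  assumes "J \<in> Gamma0" "J x = ereal a" "J y = ereal b" "0 < t" "t < 1"
  obtains k where "J ((1 - t) *\<^sub>R x + t *\<^sub>R y) = ereal k" "k \<le> (1 - t) * a + t * b"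
proof -
  let ?z = "(1 - t) *\<^sub>R x + t *\<^sub>R y"
  have "J ?z \<le> ereal ((1 - t) * a + t * b)"
    using Gamma0_D(4)[OF assms(1,4,5), of x y] assms(2,3) by simp
  moreover have "J ?z \<noteq> -\<infinity>" by (rule Gamma0_D(1)[OF assms(1)])
  ultimately show ?thesis using that by (cases "J ?z") auto
qed

text \<open>Lower semicontinuity at one point of the domain bounds the function below on a small ball, and
convexity along rays from that point propagates the bound with linear loss. Adding any positive
multiple of a squared norm therefore gives a function that is bounded below.\<close>

lemma Gamma0_conical_minorant:
  fixes J :: "'a::real_normed_vector \<Rightarrow> ereal"
  assumes "J \<in> Gamma0"
  obtains x0 j K where "J x0 = ereal j" "0 \<le> K" "\<And>z. ereal (j - 1 - K * norm (z - x0)) \<le> J z"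
proof -
  obtain x0 j where j: "J x0 = ereal j" using Gamma0_D(2)[OF assms] by auto
  have "ereal (j - 1) < J x0" using j by simp
  then obtain r where r: "0 < r" "\<And>z. dist z x0 < r \<Longrightarrow> ereal (j - 1) < J z"
    using lsc_fun_ball[OF Gamma0_D(3)[OF assms]] by metis
  have "ereal (j - 1 - 2 / r * norm (z - x0)) \<le> J z" for z
  proof (cases "norm (z - x0) < r")
    case True
    then have "ereal (j - 1) < J z" by (intro r(2)) (simp add: dist_norm)
    moreover have "j - 1 - 2 / r * norm (z - x0) \<le> j - 1" using r(1) by simp
    ultimately show ?thesis by (meson ereal_less_eq(3) less_imp_le order_trans)
  next
    case False
    show ?thesis
    proof (cases "J z")
      case (real b)
      let ?s = "norm (z - x0)"
      define t where "t = r / (2 * ?s)"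
      have s: "?s \<ge> r" "?s > 0" using False r(1) by linarith+
      have t: "0 < t" "t < 1" using s r(1) by (auto simp: t_def field_simps)
      obtain k where k: "J ((1 - t) *\<^sub>R x0 + t *\<^sub>R z) = ereal k" "k \<le> (1 - t) * j + t * b"
        using Gamma0_convex_real[OF assms j real t] .
      have "((1 - t) *\<^sub>R x0 + t *\<^sub>R z) - x0 = t *\<^sub>R (z - x0)" by (simp add: algebra_simps)
      then have "dist ((1 - t) *\<^sub>R x0 + t *\<^sub>R z) x0 = t * ?s" using t by (simp add: dist_norm)
      also have "\<dots> < r" using s r(1) by (simp add: t_def)
      finally have "j - 1 < k" using r(2) k(1) by fastforce
      then have "t * (j - b) < 1" using k(2) by (simp add: algebra_simps)
      then have "j - b < 1 / t" using t by (simp add: field_simps)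
      also have "1 / t = 2 / r * ?s" by (simp add: t_def)
      finally show ?thesis using real by simp
    qed (use Gamma0_D(1)[OF assms] in auto)
  qed
  then show ?thesis using that[OF j, of "2 / r"] r(1) by simp
qed

text \<open>The witness minimises $J + \frac\sigma2\|\cdot - c\|^2$: a minimising sequence is Cauchy by strong
midpoint convexity of the quadratic, and its limit is a minimiser by lower semicontinuity. The
optimality condition, rather than minimality itself, is recorded because it is the form in which
proximal points, conjugates and the Riesz representation are obtained below.\<close>

lemma Gamma0_prox_exists:
  fixes J :: "'a::{real_inner,complete_space} \<Rightarrow> ereal"
  assumes J: "J \<in> Gamma0" and \<sigma>: "0 < \<sigma>"
  obtains x j where "J x = ereal j" "\<sigma> *\<^sub>R (c - x) \<in> subdiff J x"
proof -
  define q where "q z = \<sigma> / 2 * (norm (z - c))\<^sup>2" for z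
  define V where "V = {j + q z | z j. J z = ereal j}"
  obtain x0 j0 K where j0: "J x0 = ereal j0" and K: "0 \<le> K"
    and minor: "\<And>z. ereal (j0 - 1 - K * norm (z - x0)) \<le> J z"
    using Gamma0_conical_minorant[OF J] by metis
  have "j0 - 1 - K * norm (c - x0) - K\<^sup>2 / (2 * \<sigma>) \<le> v" if "v \<in> V" for v
  proof -
    from that obtain z j where v: "v = j + q z" "J z = ereal j" by (auto simp: V_def)
    let ?s = "norm (z - c)"
    have "norm (z - x0) \<le> ?s + norm (c - x0)" using norm_triangle_ineq[of "z - c" "c - x0"] by simp
    then have "K * norm (z - x0) \<le> K * ?s + K * norm (c - x0)"
      using K by (metis distrib_left mult_left_mono)
    moreover have "j0 - 1 - K * norm (z - x0) \<le> j" using minor[of z] v(2) by simp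
    \<comment> \<open>The quadratic absorbs the linear loss of the minorant.\<close>
    moreover have "0 \<le> (\<sigma> * ?s - K)\<^sup>2 / (2 * \<sigma>)" using \<sigma> by simp
    then have "K * ?s \<le> \<sigma> / 2 * ?s\<^sup>2 + K\<^sup>2 / (2 * \<sigma>)"
      using \<sigma> by (simp add: power2_eq_square field_simps)
    ultimately show ?thesis by (simp add: v(1) q_def)
  qed
  then have bdd: "bdd_below V" by (meson bdd_belowI)
  have "V \<noteq> {}" using j0 by (auto simp: V_def)
  define \<mu> where "\<mu> = Inf V"
  have \<mu>: "\<mu> \<le> j + q z" if "J z = ereal j" for z j
    unfolding \<mu>_def by (rule cInf_lower[OF _ bdd]) (use that in \<open>auto simp: V_def\<close>)
  have "\<exists>z j. J z = ereal j \<and> j + q z < \<mu> + inverse (real (Suc n))" for n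
  proof -
    have "Inf V < \<mu> + inverse (real (Suc n))" by (simp add: \<mu>_def)
    then obtain v where "v \<in> V" "v < \<mu> + inverse (real (Suc n))"
      using cInf_lessD[OF \<open>V \<noteq> {}\<close>] by blast
    then show ?thesis by (auto simp: V_def)
  qed
  then obtain Z k where Z: "\<And>n. J (Z n) = ereal (k n)"
    and Zk: "\<And>n. k n + q (Z n) < \<mu> + inverse (real (Suc n))" by metis
  \<comment> \<open>Strong midpoint convexity of the quadratic, tested at two members of the minimising sequence.\<close>
  have mid: "\<sigma> / 8 * (dist (Z m) (Z n))\<^sup>2 \<le> (inverse (real (Suc m)) + inverse (real (Suc n))) / 2" for m n
  proof -
    let ?z = "(1 - 1 / 2) *\<^sub>R Z m + (1 / 2 :: real) *\<^sub>R Z n"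
    obtain l where l: "J ?z = ereal l" "l \<le> (1 - 1 / 2) * k m + (1 / 2) * k n"
      by (rule Gamma0_convex_real[OF J Z[of m] Z[of n], of "1 / 2"]) auto
    have z: "?z - c = (1 / 2) *\<^sub>R ((Z m - c) + (Z n - c))"
      by (simp add: algebra_simps flip: scaleR_add_left)
    have "q ?z = (q (Z m) + q (Z n)) / 2 - \<sigma> / 8 * (norm (Z m - Z n))\<^sup>2"
      unfolding q_def z by (simp add: power2_norm_eq_inner inner_simps inner_commute field_simps)
    then have "\<sigma> / 8 * (norm (Z m - Z n))\<^sup>2 = (q (Z m) + q (Z n)) / 2 - q ?z" by simp
    also have "\<dots> \<le> (q (Z m) + q (Z n)) / 2 + l - \<mu>" using \<mu>[OF l(1)] by simp
    also have "\<dots> \<le> ((k m + q (Z m) - \<mu>) + (k n + q (Z n) - \<mu>)) / 2" using l(2) by (simp add: field_simps)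
    also have "\<dots> \<le> (inverse (real (Suc m)) + inverse (real (Suc n))) / 2"
      using Zk[of m] Zk[of n] by (intro divide_right_mono add_mono) auto
    finally show ?thesis by (simp only: dist_norm)
  qed
  have "Cauchy Z"
  proof (rule metric_CauchyI)
    fix e :: real assume e: "0 < e"
    obtain M where M: "inverse (real (Suc M)) < \<sigma> / 8 * e\<^sup>2"
      using reals_Archimedean[of "\<sigma> / 8 * e\<^sup>2"] \<sigma> e by auto
    have "dist (Z m) (Z n) < e" if "M \<le> m" "M \<le> n" for m n
    proof -
      have "inverse (real (Suc m)) \<le> inverse (real (Suc M))"
        "inverse (real (Suc n)) \<le> inverse (real (Suc M))" using that by auto
      then have "\<sigma> / 8 * (dist (Z m) (Z n))\<^sup>2 < \<sigma> / 8 * e\<^sup>2" using mid[of m n] M by argo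
      then have "(dist (Z m) (Z n))\<^sup>2 < e\<^sup>2" using \<sigma> by simp
      then show ?thesis using e by (simp add: power2_less_imp_less)
    qed
    then show "\<exists>M. \<forall>m\<ge>M. \<forall>n\<ge>M. dist (Z m) (Z n) < e" by blast
  qed
  then obtain x where x: "Z \<longlonglongrightarrow> x" using Cauchy_convergent convergent_def by blast
  have qx: "(\<lambda>n. q (Z n)) \<longlonglongrightarrow> q x" unfolding q_def by (intro tendsto_intros x)
  \<comment> \<open>Lower semicontinuity along the sequence; the value at its limit is not yet known to be finite.\<close>
  have lower: "C \<le> \<mu> - q x" if C: "ereal C < J x" for C
  proof -
    obtain r where r: "0 < r" "\<And>z. dist z x < r \<Longrightarrow> ereal C < J z"
      using lsc_fun_ball[OF Gamma0_D(3)[OF J] C] by metis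
    have "eventually (\<lambda>n. C \<le> \<mu> + inverse (real (Suc n)) - q (Z n)) sequentially"
      using tendstoD[OF x r(1)]
    proof eventually_elim
      case (elim n)
      then have "C < k n" using r(2)[of "Z n"] Z by simp
      then show ?case using Zk[of n] by simp
    qed
    moreover have "(\<lambda>n. \<mu> + inverse (real (Suc n)) - q (Z n)) \<longlonglongrightarrow> \<mu> + 0 - q x"
      by (intro tendsto_intros qx LIMSEQ_inverse_real_of_nat)
    ultimately show ?thesis using tendsto_lowerbound by force
  qed
  have "J x \<le> ereal (\<mu> - q x)"
  proof (rule ccontr)
    assume "\<not> J x \<le> ereal (\<mu> - q x)"
    then obtain C where "ereal (\<mu> - q x) < ereal C" "ereal C < J x"
      using ereal_dense2 by (metis not_le)
    then show False using lower by fastforce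
  qed
  then obtain j where j: "J x = ereal j" "j \<le> \<mu> - q x"
    using Gamma0_D(1)[OF J, of x] by (cases "J x") auto
  have "J x + ereal ((z - x) \<bullet> (\<sigma> *\<^sub>R (c - x))) \<le> J z" for z
  proof (cases "J z")
    case (real b)
    let ?h = "z - x"
    \<comment> \<open>Minimality compared with the points of the segment towards $z$, after division by its parameter.\<close>
    have ineq: "0 \<le> (b - j - ?h \<bullet> (\<sigma> *\<^sub>R (c - x))) + t * (\<sigma> / 2 * (norm ?h)\<^sup>2)" if t: "0 < t" "t < 1" for t
    proof -
      obtain l where l: "J ((1 - t) *\<^sub>R x + t *\<^sub>R z) = ereal l" "l \<le> (1 - t) * j + t * b"
        using Gamma0_convex_real[OF J j(1) real t] .
      have e: "(1 - t) *\<^sub>R x + t *\<^sub>R z - c = (x - c) + t *\<^sub>R ?h" by (simp add: algebra_simps)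
      have "q ((1 - t) *\<^sub>R x + t *\<^sub>R z)
          = q x - t * (?h \<bullet> (\<sigma> *\<^sub>R (c - x))) + t * t * (\<sigma> / 2 * (norm ?h)\<^sup>2)"
        unfolding q_def e power2_norm_eq_inner
        by (simp add: inner_simps inner_commute algebra_simps)
      then have "0 \<le> t * ((b - j - ?h \<bullet> (\<sigma> *\<^sub>R (c - x))) + t * (\<sigma> / 2 * (norm ?h)\<^sup>2))"
        using \<mu>[OF l(1)] l(2) j(2) by (simp add: algebra_simps)
      then show ?thesis using t by (simp add: zero_le_mult_iff)
    qed
    have "((\<lambda>t. (b - j - ?h \<bullet> (\<sigma> *\<^sub>R (c - x))) + t * (\<sigma> / 2 * (norm ?h)\<^sup>2))
        \<longlongrightarrow> (b - j - ?h \<bullet> (\<sigma> *\<^sub>R (c - x))) + 0 * (\<sigma> / 2 * (norm ?h)\<^sup>2)) (at_right 0)"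
      by (intro tendsto_intros)
    moreover have "eventually (\<lambda>t. 0 \<le> (b - j - ?h \<bullet> (\<sigma> *\<^sub>R (c - x))) + t * (\<sigma> / 2 * (norm ?h)\<^sup>2)) (at_right 0)"
      using eventually_at_right_real[of 0 "1::real"]
      by (rule eventually_mono[OF _ ineq]) auto
    ultimately have "0 \<le> b - j - ?h \<bullet> (\<sigma> *\<^sub>R (c - x))"
      using tendsto_lowerbound[OF _ _ trivial_limit_at_right_real] by force
    then show ?thesis using j real by simp
  qed (use Gamma0_D(1)[OF J] in auto)
  then show ?thesis using that j(1) by (auto simp: subdiff_def)
qed

text \<open>The optimality condition at the point supplied by the preceding existence lemma gives quadratic
growth of the proximal objective there, so that point is the only minimiser and is the one that the
choice operator selects.\<close>

lemma prox_subgradient: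
  fixes \<phi> :: "'a::{real_inner,complete_space} \<Rightarrow> ereal"
  assumes \<phi>: "\<phi> \<in> Gamma0" and c: "0 < c"
  obtains b where "\<phi> (prox (\<lambda>v. ereal c * \<phi> v) x) = ereal b"
    "(1 / c) *\<^sub>R (x - prox (\<lambda>v. ereal c * \<phi> v) x) \<in> subdiff \<phi> (prox (\<lambda>v. ereal c * \<phi> v) x)"
proof -
  define q where "q z = ereal c * \<phi> z + ereal (1 / 2 * (norm (z - x))\<^sup>2)" for z
  obtain p b where b: "\<phi> p = ereal b" and s: "(1 / c) *\<^sub>R (x - p) \<in> subdiff \<phi> p"
    using Gamma0_prox_exists[OF \<phi>, of "1 / c" x] c by auto
  have qp: "q p = ereal (c * b + 1 / 2 * (norm (p - x))\<^sup>2)" by (simp add: q_def b)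
  have grow: "ereal (c * b + 1 / 2 * (norm (p - x))\<^sup>2 + 1 / 2 * (norm (z - p))\<^sup>2) \<le> q z" for z
  proof (cases "\<phi> z")
    case (real d)
    have "b + (1 / c) * ((z - p) \<bullet> (x - p)) \<le> d" using s[unfolded subdiff_def, simplified, rule_format, of z] real b by simp
    then have "c * b + (z - p) \<bullet> (x - p) \<le> c * d" using c by (simp add: field_simps)
    moreover have "(norm (z - x))\<^sup>2 = (norm (p - x))\<^sup>2 + (norm (z - p))\<^sup>2 - 2 * ((z - p) \<bullet> (x - p))"
      by (simp add: power2_norm_eq_inner inner_simps inner_commute)
    ultimately show ?thesis by (simp add: q_def real diff_divide_distrib add_divide_distrib)
  next
    case PInf
    then show ?thesis using c by (simp add: q_def)
  next
    case MInf
    then show ?thesis using Gamma0_D(1)[OF \<phi>] by simp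
  qed
  have min: "q p \<le> q z" for z
  proof -
    have "q p \<le> ereal (c * b + 1 / 2 * (norm (p - x))\<^sup>2 + 1 / 2 * (norm (z - p))\<^sup>2)" by (simp add: qp)
    then show ?thesis using grow[of z] by (rule order_trans)
  qed
  have "prox (\<lambda>v. ereal c * \<phi> v) x = p"
    unfolding prox_def arg_min_def q_def[symmetric]
  proof (rule some_equality)
    show "is_arg_min q (\<lambda>_. True) p" using min by (simp add: is_arg_min_def not_less)
    fix z assume "is_arg_min q (\<lambda>_. True) z"
    then have "q z \<le> q p" by (simp add: is_arg_min_def not_less)
    then show "z = p" using order_trans[OF grow[of z]] unfolding qp by fastforce
  qed
  then show ?thesis using that b s by simp
qed

section \<open>Conjugates\<close>

lemma fenchel_young: "ereal (x \<bullet> v) - f x \<le> conj_fun f v"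
  unfolding conj_fun_def by (rule SUP_upper) simp

lemma conj_fun_leI: "(\<And>x. ereal (x \<bullet> v) - f x \<le> c) \<Longrightarrow> conj_fun f v \<le> c"
  unfolding conj_fun_def by (rule SUP_least)

text \<open>Equality case of the Fenchel-Young inequality.\<close>

lemma subdiff_conj_fun:
  assumes "v \<in> subdiff f x" "f x = ereal a"
  shows "conj_fun f v = ereal (x \<bullet> v - a)"
proof (rule antisym)
  show "conj_fun f v \<le> ereal (x \<bullet> v - a)"
  proof (rule conj_fun_leI)
    fix z
    have "ereal (a + (z - x) \<bullet> v) \<le> f z" using assms by (simp add: subdiff_def)
    then show "ereal (z \<bullet> v) - f z \<le> ereal (x \<bullet> v - a)"
      by (cases "f z") (auto simp: inner_diff_left)
  qed
  show "ereal (x \<bullet> v - a) \<le> conj_fun f v" using fenchel_young[of x v f] assms(2) by simp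
qed

text \<open>Completing the square in $J(z) + \frac\sigma2\|z\|^2 - \langle z,v\rangle$ leads to the proximal
objective of $J$ with centre $v/\sigma$, so the supremum in the conjugate is attained, with
quadratic growth away from the maximiser.\<close>

lemma conj_fun_strongly_convex:
  fixes F J :: "'a::{real_inner,complete_space} \<Rightarrow> ereal"
  assumes J: "J \<in> Gamma0" and \<sigma>: "0 < \<sigma>" and F: "\<And>z. F z = J z + ereal (\<sigma> / 2 * (norm z)\<^sup>2)"
  obtains x a where "F x = ereal a" "conj_fun F v = ereal (x \<bullet> v - a)"
    "\<And>z. ereal (a + (z - x) \<bullet> v + \<sigma> / 2 * (norm (z - x))\<^sup>2) \<le> F z"
proof -
  obtain x j where j: "J x = ereal j" and s: "\<sigma> *\<^sub>R ((1 / \<sigma>) *\<^sub>R v - x) \<in> subdiff J x"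
    using Gamma0_prox_exists[OF J \<sigma>] by metis
  define a where "a = j + \<sigma> / 2 * (norm x)\<^sup>2"
  have a: "F x = ereal a" by (simp add: F j a_def)
  have grow: "ereal (a + (z - x) \<bullet> v + \<sigma> / 2 * (norm (z - x))\<^sup>2) \<le> F z" for z
  proof -
    have "\<sigma> *\<^sub>R ((1 / \<sigma>) *\<^sub>R v - x) = v - \<sigma> *\<^sub>R x" using \<sigma> by (simp add: scaleR_diff_right)
    then have "ereal (j + (z - x) \<bullet> (v - \<sigma> *\<^sub>R x)) \<le> J z" using s j by (simp add: subdiff_def)
    then have "ereal (j + (z - x) \<bullet> (v - \<sigma> *\<^sub>R x)) + ereal (\<sigma> / 2 * (norm z)\<^sup>2) \<le> F z"
      unfolding F by (rule add_right_mono)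
    moreover have "j + (z - x) \<bullet> (v - \<sigma> *\<^sub>R x) + \<sigma> / 2 * (norm z)\<^sup>2
        = a + (z - x) \<bullet> v + \<sigma> / 2 * (norm (z - x))\<^sup>2"
      by (simp add: a_def power2_norm_eq_inner inner_simps inner_commute field_simps)
    ultimately show ?thesis by simp
  qed
  have "F x + ereal ((z - x) \<bullet> v) \<le> F z" for z
  proof -
    have "F x + ereal ((z - x) \<bullet> v) \<le> ereal (a + (z - x) \<bullet> v + \<sigma> / 2 * (norm (z - x))\<^sup>2)"
      using a \<sigma> by simp
    also have "\<dots> \<le> F z" by (rule grow)
    finally show ?thesis .
  qed
  then have "conj_fun F v = ereal (x \<bullet> v - a)"
    by (intro subdiff_conj_fun[of v F x, OF _ a]) (simp add: subdiff_def)
  then show ?thesis using that a grow by blast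
qed

text \<open>Uniqueness of the gradient, which makes the definite description well defined.\<close>

lemma grad_eqI:
  fixes f :: "'a::real_inner \<Rightarrow> ereal"
  assumes fin: "\<And>z. f z = ereal (r z)" and der: "GDERIV r v :> g"
  shows "grad f v = g"
proof -
  have r: "(\<lambda>z. real_of_ereal (f z)) = r" by (simp add: fin)
  have uniq: "h = g" if "GDERIV r v :> h" for h
  proof -
    have "(\<lambda>z. z \<bullet> h) = (\<lambda>z. z \<bullet> g)"
      using that der unfolding gderiv_def by (rule has_derivative_unique)
    then have "z \<bullet> h = z \<bullet> g" for z by meson
    then show ?thesis by (metis inner_commute vector_eq_ldot)
  qed
  have "eventually (\<lambda>z. \<bar>f z\<bar> \<noteq> \<infinity>) (nhds v)" by (simp add: fin)
  then show ?thesis unfolding grad_def r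
    by (intro the_equality) (use der in blast, use uniq in blast)
qed

lemma inner_le_Young:
  fixes d e :: "'a::real_inner"
  assumes "0 < \<sigma>"
  shows "d \<bullet> e \<le> \<sigma> / 2 * (norm d)\<^sup>2 + (norm e)\<^sup>2 / (2 * \<sigma>)"
proof -
  have "(norm (\<sigma> *\<^sub>R d - e))\<^sup>2 = 2 * \<sigma> * (\<sigma> / 2 * (norm d)\<^sup>2 + (norm e)\<^sup>2 / (2 * \<sigma>) - d \<bullet> e)"
    using assms by (simp add: power2_norm_eq_inner inner_simps inner_commute field_simps)
  then have "0 \<le> 2 * \<sigma> * (\<sigma> / 2 * (norm d)\<^sup>2 + (norm e)\<^sup>2 / (2 * \<sigma>) - d \<bullet> e)"
    by (metis zero_le_power2)
  then show ?thesis using assms by (simp add: zero_le_mult_iff)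
qed

text \<open>The maximiser attached to $v$ is a subgradient of the conjugate, and quadratic growth around it
gives a quadratic upper bound by Young's inequality. Squeezed between the two bounds, the conjugate
is differentiable and the maximiser is its gradient. Both bounds are what the forward step uses, so
Lipschitz continuity of the gradient need not be derived.\<close>

lemma conj_fun_strongly_convex_smooth:
  fixes F J :: "'a::{real_inner,complete_space} \<Rightarrow> ereal"
  assumes J: "J \<in> Gamma0" and \<sigma>: "0 < \<sigma>" and F: "\<And>z. F z = J z + ereal (\<sigma> / 2 * (norm z)\<^sup>2)"
  obtains s where "\<And>v. conj_fun F v = ereal (s v)"
    "\<And>v. F (grad (conj_fun F) v) = ereal (grad (conj_fun F) v \<bullet> v - s v)"
    "\<And>v z. ereal (z \<bullet> v - s v + \<sigma> / 2 * (norm (z - grad (conj_fun F) v))\<^sup>2) \<le> F z"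
    "\<And>v v'. s v + grad (conj_fun F) v \<bullet> (v' - v) \<le> s v'"
    "\<And>v v'. s v' \<le> s v + grad (conj_fun F) v \<bullet> (v' - v) + (norm (v' - v))\<^sup>2 / (2 * \<sigma>)"
proof -
  have "\<exists>x a. F x = ereal a \<and> conj_fun F v = ereal (x \<bullet> v - a) \<and>
    (\<forall>z. ereal (a + (z - x) \<bullet> v + \<sigma> / 2 * (norm (z - x))\<^sup>2) \<le> F z)" for v
    using conj_fun_strongly_convex[OF J \<sigma> F, of v] by metis
  then obtain g a where a: "\<And>v. F (g v) = ereal (a v)"
    and conj: "\<And>v. conj_fun F v = ereal (g v \<bullet> v - a v)"
    and grow: "\<And>v z. ereal (a v + (z - g v) \<bullet> v + \<sigma> / 2 * (norm (z - g v))\<^sup>2) \<le> F z"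
    by metis
  define s where "s v = g v \<bullet> v - a v" for v
  have low: "s v + g v \<bullet> (v' - v) \<le> s v'" for v v'
  proof -
    have "ereal (g v \<bullet> v') - F (g v) \<le> conj_fun F v'" unfolding conj_fun_def by (rule SUP_upper) simp
    then show ?thesis by (simp add: a conj s_def inner_simps)
  qed
  have up: "s v' \<le> s v + g v \<bullet> (v' - v) + (norm (v' - v))\<^sup>2 / (2 * \<sigma>)" for v v'
  proof -
    let ?d = "g v' - g v" and ?e = "v' - v"
    have "a v + ?d \<bullet> v + \<sigma> / 2 * (norm ?d)\<^sup>2 \<le> a v'" using grow[of v "g v'"] a by simp
    moreover have "?d \<bullet> ?e \<le> \<sigma> / 2 * (norm ?d)\<^sup>2 + (norm ?e)\<^sup>2 / (2 * \<sigma>)"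
      by (rule inner_le_Young[OF \<sigma>])
    ultimately show ?thesis by (simp add: s_def inner_simps)
  qed
  have der: "GDERIV s v :> g v" for v
    unfolding gderiv_def
  proof (rule has_derivativeI_sandwich[of 1 _ _ _ _ "\<lambda>z. norm (z - v) / (2 * \<sigma>)"])
    show "bounded_linear (\<lambda>h. h \<bullet> g v)" by (rule bounded_linear_inner_left)
    have "((\<lambda>z. norm (z - v) / (2 * \<sigma>)) \<longlongrightarrow> norm (v - v) / (2 * \<sigma>)) (at v)"
      using \<sigma> by (intro tendsto_intros) auto
    then show "((\<lambda>z. norm (z - v) / (2 * \<sigma>)) \<longlongrightarrow> 0) (at v)" by simp
    fix z assume "z \<noteq> v"
    have "s v + g v \<bullet> (z - v) \<le> s z" by (rule low)
    moreover have "s z \<le> s v + g v \<bullet> (z - v) + (norm (z - v))\<^sup>2 / (2 * \<sigma>)" by (rule up)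
    ultimately have "norm (s z - s v - (z - v) \<bullet> g v) \<le> (norm (z - v))\<^sup>2 / (2 * \<sigma>)"
      by (simp add: inner_commute)
    then show "norm (s z - s v - (z - v) \<bullet> g v) / norm (z - v) \<le> norm (z - v) / (2 * \<sigma>)"
      using \<open>z \<noteq> v\<close> \<sigma> by (simp add: field_simps power2_eq_square)
  qed auto
  have s: "conj_fun F v = ereal (s v)" for v by (simp add: s_def conj)
  have g: "grad (conj_fun F) v = g v" for v using grad_eqI[OF s der] .
  have Fg: "F (g v) = ereal (g v \<bullet> v - s v)" for v by (simp add: a s_def)
  have grow': "ereal (z \<bullet> v - s v + \<sigma> / 2 * (norm (z - g v))\<^sup>2) \<le> F z" for z v
    using grow[of v z] by (simp add: s_def inner_simps algebra_simps)
  show ?thesis by (rule that[of s], unfold g) (fact s Fg grow' low up)+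
qed

text \<open>One inequality adds the Fenchel-Young inequalities of the two functions. The other restricts the
double supremum over $x'$ and $x - x'$ to $x' = a$, where the first conjugate is attained.\<close>

lemma conj_fun_inf_conv:
  fixes \<psi> \<phi> :: "'a::real_inner \<Rightarrow> ereal"
  assumes \<psi>: "\<And>x. \<psi> x \<noteq> -\<infinity>" and \<phi>: "\<And>x. \<phi> x \<noteq> -\<infinity>" "\<phi> b = ereal \<beta>"
    and a: "\<psi> a = ereal \<alpha>" "conj_fun \<psi> u = ereal (a \<bullet> u - \<alpha>)"
  shows "conj_fun (inf_conv \<psi> \<phi>) u = conj_fun \<psi> u + conj_fun \<phi> u"
proof (rule antisym)
  have ninf: "conj_fun \<phi> u \<noteq> -\<infinity>" using fenchel_young[of b u \<phi>] \<phi>(2) by auto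
  show "conj_fun (inf_conv \<psi> \<phi>) u \<le> conj_fun \<psi> u + conj_fun \<phi> u"
  proof (cases "conj_fun \<phi> u")
    case (real s)
    show ?thesis
    proof (rule conj_fun_leI)
      fix x
      have "ereal (x \<bullet> u - (a \<bullet> u - \<alpha> + s)) \<le> inf_conv \<psi> \<phi> x"
        unfolding inf_conv_def
      proof (rule INF_greatest)
        fix x'
        have "ereal (x' \<bullet> u) - \<psi> x' \<le> ereal (a \<bullet> u - \<alpha>)" using fenchel_young[of x' u \<psi>] a(2) by simp
        moreover have "ereal ((x - x') \<bullet> u) - \<phi> (x - x') \<le> ereal s"
          using fenchel_young[of "x - x'" u \<phi>] real by simp
        ultimately show "ereal (x \<bullet> u - (a \<bullet> u - \<alpha> + s)) \<le> \<psi> x' + \<phi> (x - x')"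
          using \<psi>[of x'] \<phi>(1)[of "x - x'"]
          by (cases "\<psi> x'"; cases "\<phi> (x - x')") (auto simp: inner_diff_left)
      qed
      then show "ereal (x \<bullet> u) - inf_conv \<psi> \<phi> x \<le> conj_fun \<psi> u + conj_fun \<phi> u"
        unfolding a(2) real by (cases "inf_conv \<psi> \<phi> x") auto
    qed
  qed (use ninf a in auto)
  have "conj_fun \<phi> u \<le> conj_fun (inf_conv \<psi> \<phi>) u - ereal (a \<bullet> u - \<alpha>)"
  proof (rule conj_fun_leI)
    fix x
    have "inf_conv \<psi> \<phi> (a + x) \<le> \<psi> a + \<phi> (a + x - a)"
      unfolding inf_conv_def by (rule INF_lower) simp
    then have "inf_conv \<psi> \<phi> (a + x) \<le> ereal \<alpha> + \<phi> x" using a(1) by simp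
    moreover have "ereal ((a + x) \<bullet> u) - inf_conv \<psi> \<phi> (a + x) \<le> conj_fun (inf_conv \<psi> \<phi>) u"
      by (rule fenchel_young)
    ultimately show "ereal (x \<bullet> u) - \<phi> x \<le> conj_fun (inf_conv \<psi> \<phi>) u - ereal (a \<bullet> u - \<alpha>)"
      using \<phi>(1)[of x]
      by (cases "\<phi> x"; cases "inf_conv \<psi> \<phi> (a + x)"; cases "conj_fun (inf_conv \<psi> \<phi>) u")
        (auto simp: inner_add_left)
  qed
  then show "conj_fun \<psi> u + conj_fun \<phi> u \<le> conj_fun (inf_conv \<psi> \<phi>) u"
    unfolding a(2) using ninf by (cases "conj_fun \<phi> u"; cases "conj_fun (inf_conv \<psi> \<phi>) u") auto
qed

section \<open>The adjoint on a Hilbert space\<close>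

text \<open>The adjoint is defined by choice, so it satisfies its defining equation as soon as some operator
does. This is the Riesz representation theorem for $x \mapsto \langle Ax,y\rangle$, whose representing
vector is the minimiser of $\frac12\|x\|^2 - \langle Ax,y\rangle$.\<close>

lemma adjoint_inner:
  fixes A :: "'a::{real_inner,complete_space} \<Rightarrow> 'b::real_inner"
  assumes A: "bounded_linear A"
  shows "A x \<bullet> y = x \<bullet> adjoint A y"
proof -
  have "\<exists>z. \<forall>x. A x \<bullet> y = x \<bullet> z" for y
  proof -
    interpret bounded_linear A by (rule A)
    define J where "J x = ereal (- (A x \<bullet> y))" for x
    have "lsc_fun J"
      unfolding lsc_fun_def J_def
    proof
      fix x
      have "((\<lambda>x. ereal (- (A x \<bullet> y))) \<longlongrightarrow> ereal (- (A x \<bullet> y))) (at x)"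
        by (intro tendsto_ereal tendsto_minus tendsto_inner tendsto_const tendsto[OF tendsto_ident_at])
      note lim_imp_Liminf[OF _ this]
      then show "ereal (- (A x \<bullet> y)) \<le> Liminf (at x) (\<lambda>x. ereal (- (A x \<bullet> y)))"
        by (cases "at x = bot") simp_all
    qed
    moreover have "proper_fun J" by (auto simp: proper_fun_def edom_def J_def)
    moreover have "convex_fun J" by (auto simp: convex_fun_def J_def add scaleR inner_simps)
    ultimately have "J \<in> Gamma0" by (simp add: Gamma0_def)
    then obtain z where z: "1 *\<^sub>R (0 - z) \<in> subdiff J z" using Gamma0_prox_exists[of J 1 0] by auto
    have le: "A x \<bullet> y \<le> x \<bullet> z" for x
      using z[unfolded subdiff_def J_def, simplified, rule_format, of "z + x"]
      by (simp add: add inner_simps)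
    have "A x \<bullet> y = x \<bullet> z" for x using le[of x] le[of "- x"] by (simp add: linear_simps(4)[OF A])
    then show ?thesis by blast
  qed
  then have "\<exists>f'. \<forall>x y. A x \<bullet> y = x \<bullet> f' y" by metis
  then show ?thesis unfolding adjoint_def by (rule someI2_ex) blast
qed

lemma adjoint_uminus:
  fixes A :: "'a::{real_inner,complete_space} \<Rightarrow> 'b::real_inner"
  assumes "bounded_linear A"
  shows "adjoint A (- y) = - adjoint A y"
proof -
  have "x \<bullet> adjoint A (- y) = x \<bullet> - adjoint A y" for x
    by (simp flip: adjoint_inner[OF assms])
  then show ?thesis using vector_eq_ldot by blast
qed

lemma norm_adjoint_diff_le:
  fixes A :: "'a::{real_inner,complete_space} \<Rightarrow> 'b::real_inner"
  assumes A: "bounded_linear A"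
  shows "norm (adjoint A y - adjoint A z) \<le> onorm A * norm (y - z)"
proof -
  let ?w = "adjoint A y - adjoint A z"
  have "norm ?w * norm ?w = ?w \<bullet> adjoint A y - ?w \<bullet> adjoint A z"
    by (simp flip: power2_eq_square inner_diff_right add: power2_norm_eq_inner)
  also have "\<dots> = A ?w \<bullet> (y - z)"
    by (simp flip: adjoint_inner[OF A] add: inner_diff_right)
  also have "\<dots> \<le> norm (A ?w) * norm (y - z)" by (rule norm_cauchy_schwarz)
  also have "\<dots> \<le> (onorm A * norm ?w) * norm (y - z)" by (intro mult_right_mono onorm[OF A]) simp
  finally have "norm ?w * norm ?w \<le> norm ?w * (onorm A * norm (y - z))" by (simp add: ac_simps)
  then show ?thesis
    using onorm_pos_le[OF A] by (cases "norm ?w = 0") auto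
qed

section \<open>Weak limits of bounded sequences\<close>

text \<open>By separation, this says that $v$ belongs to the closed convex hull of every tail of $u$. Every weak
cluster point is of this kind, and the property is strong enough to identify limits of scalar
products and to bound the values of convex functions.\<close>

definition tail_hull_point :: "(nat \<Rightarrow> 'a::real_inner) \<Rightarrow> 'a \<Rightarrow> bool" where
  "tail_hull_point u v \<longleftrightarrow> (\<forall>h j e. 0 < e \<longrightarrow> (\<exists>k\<ge>j. v \<bullet> h - e \<le> u k \<bullet> h))"

text \<open>Almost norm-minimal points of the convex hulls of the tails form a Cauchy sequence: the minimal
norms increase and stay bounded, and the parallelogram identity controls the distances by their
differences.\<close>

lemma tail_hull_point_exists:
  fixes u :: "nat \<Rightarrow> 'a::{real_inner,complete_space}"
  assumes "bounded (range u)"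
  obtains v where "tail_hull_point u v"
proof -
  define H where "H j = convex hull (u ` {j..})" for j
  define \<delta> where "\<delta> j = Inf ((\<lambda>x. (norm x)\<^sup>2) ` H j)" for j
  obtain B where B: "\<And>n. norm (u n) \<le> B" using assms by (auto simp: bounded_iff)
  have uH: "u j \<in> H j" for j unfolding H_def by (rule hull_inc) auto
  have bdd: "bdd_below ((\<lambda>x. (norm x)\<^sup>2) ` H j)" for j by (rule bdd_belowI2[of _ 0]) simp
  have H_mono: "H i \<subseteq> H j" if "j \<le> i" for i j
    unfolding H_def by (rule hull_mono) (use that in auto)
  have \<delta>_le: "\<delta> j \<le> (norm x)\<^sup>2" if "x \<in> H j" for x j
    unfolding \<delta>_def by (rule cINF_lower[OF bdd that])
  have \<delta>_mono: "\<delta> j \<le> \<delta> i" if "j \<le> i" for i j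
    unfolding \<delta>_def
    by (rule cINF_superset_mono) (use H_mono[OF that] uH bdd in auto)
  have "convergent \<delta>"
  proof (rule Bseq_monoseq_convergent[OF BseqI'])
    fix n
    have "0 \<le> \<delta> n" unfolding \<delta>_def using uH by (intro cINF_greatest) auto
    moreover have "\<delta> n \<le> B\<^sup>2" by (rule order_trans[OF \<delta>_le[OF uH]]) (simp add: B power_mono)
    ultimately show "norm (\<delta> n) \<le> B\<^sup>2" by simp
    show "monoseq \<delta>" using \<delta>_mono by (simp add: monoseq_def)
  qed
  then have cauchy: "Cauchy \<delta>" by (rule convergent_Cauchy)
  have "\<exists>x\<in>H j. (norm x)\<^sup>2 < \<delta> j + inverse (real (Suc j))" for j
  proof -
    have "Inf ((\<lambda>x. (norm x)\<^sup>2) ` H j) < \<delta> j + inverse (real (Suc j))" by (simp add: \<delta>_def)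
    then show ?thesis using uH[of j] by (subst (asm) cInf_less_iff[OF _ bdd]) auto
  qed
  then obtain p where pH: "\<And>j. p j \<in> H j"
    and p: "\<And>j. (norm (p j))\<^sup>2 < \<delta> j + inverse (real (Suc j))" by metis
  have gap: "(dist (p i) (p j))\<^sup>2 \<le> 2 * (\<delta> i - \<delta> j) + 4 * inverse (real (Suc j))" if ij: "j \<le> i" for i j
  proof -
    let ?m = "(1 / 2) *\<^sub>R p i + (1 / 2) *\<^sub>R p j"
    have "?m \<in> H j"
      using H_mono[OF ij] pH unfolding H_def
      by (intro convexD[OF convex_convex_hull]) auto
    then have "\<delta> j \<le> (norm ?m)\<^sup>2" by (rule \<delta>_le)
    moreover have "(dist (p i) (p j))\<^sup>2 = 2 * (norm (p i))\<^sup>2 + 2 * (norm (p j))\<^sup>2 - 4 * (norm ?m)\<^sup>2"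
      unfolding dist_norm power2_norm_eq_inner by (simp add: inner_simps inner_commute)
    moreover have "inverse (real (Suc i)) \<le> inverse (real (Suc j))" using ij by simp
    ultimately show ?thesis using p[of i] p[of j] by argo
  qed
  have "Cauchy p"
  proof (rule metric_CauchyI)
    fix e :: real assume e: "0 < e"
    have e8: "0 < e\<^sup>2 / 8" using e by simp
    obtain M where M: "\<And>i j. M \<le> i \<Longrightarrow> M \<le> j \<Longrightarrow> dist (\<delta> i) (\<delta> j) < e\<^sup>2 / 8"
      using metric_CauchyD[OF cauchy e8] by blast
    obtain M' where M': "inverse (real (Suc M')) < e\<^sup>2 / 8" using reals_Archimedean[OF e8] by auto
    have le: "dist (p i) (p j) < e" if "max M M' \<le> j" "j \<le> i" for i j
    proof -
      have "inverse (real (Suc j)) \<le> inverse (real (Suc M'))" using that by simp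
      moreover have "\<delta> i - \<delta> j < e\<^sup>2 / 8" using M[of i j] that abs_ge_self[of "\<delta> i - \<delta> j"] unfolding dist_real_def by force
      ultimately have "(dist (p i) (p j))\<^sup>2 < e\<^sup>2" using gap[OF that(2)] M' e8 by argo
      then show ?thesis using e by (simp add: power2_less_imp_less)
    qed
    have "dist (p i) (p j) < e" if "max M M' \<le> i" "max M M' \<le> j" for i j
      using le[of i j] le[of j i] that by (metis dist_commute linear)
    then show "\<exists>M. \<forall>m\<ge>M. \<forall>n\<ge>M. dist (p m) (p n) < e" by blast
  qed
  then obtain v where v: "p \<longlonglongrightarrow> v" using Cauchy_convergent convergent_def by blast
  have "\<exists>k\<ge>j. v \<bullet> h - e \<le> u k \<bullet> h" if "0 < e" for h j e
  proof (rule ccontr)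
    assume "\<not> (\<exists>k\<ge>j. v \<bullet> h - e \<le> u k \<bullet> h)"
    then have "u ` {j..} \<subseteq> {x. h \<bullet> x \<le> v \<bullet> h - e}" by (fastforce simp: inner_commute)
    then have "H j \<subseteq> {x. h \<bullet> x \<le> v \<bullet> h - e}"
      unfolding H_def by (rule hull_minimal) (rule convex_halfspace_le)
    then have "h \<bullet> p i \<le> v \<bullet> h - e" if "j \<le> i" for i using H_mono[OF that] pH[of i] by blast
    then have "eventually (\<lambda>i. h \<bullet> p i \<le> v \<bullet> h - e) sequentially"
      by (auto simp: eventually_sequentially)
    moreover have "(\<lambda>i. h \<bullet> p i) \<longlonglongrightarrow> h \<bullet> v" by (intro tendsto_intros v)
    ultimately have "h \<bullet> v \<le> v \<bullet> h - e" using tendsto_upperbound by force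
    then show False using that by (simp add: inner_commute)
  qed
  then show ?thesis using that[of v] unfolding tail_hull_point_def by blast
qed

lemma tail_hull_point_le:
  assumes "tail_hull_point u v" "eventually (\<lambda>n. u n \<bullet> h \<le> c) sequentially"
  shows "v \<bullet> h \<le> c"
proof (rule field_le_epsilon)
  fix e :: real assume "0 < e"
  obtain j where j: "\<And>k. j \<le> k \<Longrightarrow> u k \<bullet> h \<le> c" using assms(2) by (auto simp: eventually_sequentially)
  obtain k where "k \<ge> j" "v \<bullet> h - e \<le> u k \<bullet> h"
    using assms(1) \<open>0 < e\<close> unfolding tail_hull_point_def by meson
  then show "v \<bullet> h \<le> c + e" using j[of k] by linarith
qed

lemma tail_hull_point_ge:
  assumes "tail_hull_point u v" "eventually (\<lambda>n. c \<le> u n \<bullet> h) sequentially"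
  shows "c \<le> v \<bullet> h"
  using tail_hull_point_le[OF assms(1), of "- h" "- c"] assms(2) by simp

lemma tail_hull_point_lim:
  assumes "tail_hull_point u v" "(\<lambda>n. u n \<bullet> h) \<longlonglongrightarrow> l"
  shows "v \<bullet> h = l"
proof (rule antisym)
  show "v \<bullet> h \<le> l"
  proof (rule dense_ge)
    fix c assume "l < c"
    then have "eventually (\<lambda>n. u n \<bullet> h \<le> c) sequentially"
      using order_tendstoD(2)[OF assms(2) \<open>l < c\<close>] by (auto elim: eventually_mono)
    then show "v \<bullet> h \<le> c" by (rule tail_hull_point_le[OF assms(1)])
  qed
  show "l \<le> v \<bullet> h"
  proof (rule dense_le)
    fix c assume "c < l"
    then have "eventually (\<lambda>n. c \<le> u n \<bullet> h) sequentially"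
      using order_tendstoD(1)[OF assms(2) \<open>c < l\<close>] by (auto elim: eventually_mono)
    then show "c \<le> v \<bullet> h" by (rule tail_hull_point_ge[OF assms(1)])
  qed
qed

lemma tail_hull_point_subseq:
  assumes "strict_mono r" "tail_hull_point (u \<circ> r) v"
  shows "tail_hull_point u v"
  unfolding tail_hull_point_def
proof (intro allI impI)
  fix h j and e :: real assume "0 < e"
  then obtain k where "k \<ge> j" "v \<bullet> h - e \<le> u (r k) \<bullet> h"
    using assms(2) unfolding tail_hull_point_def comp_def by meson
  then show "\<exists>k\<ge>j. v \<bullet> h - e \<le> u k \<bullet> h"
    using seq_suble[OF assms(1), of k] order_trans by blast
qed

text \<open>A subgradient at $v$ supports the function by an affine one, and affine functions at $v$ are
controlled by the tails. This is the weak lower semicontinuity of convex functions.\<close>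

lemma tail_hull_point_value_le:
  fixes d :: "'a::real_inner \<Rightarrow> real"
  assumes v: "tail_hull_point u v"
    and subgrad: "\<And>y. d v + (y - v) \<bullet> g \<le> d y"
    and le: "\<And>e. 0 < e \<Longrightarrow> eventually (\<lambda>n. d (u n) \<le> c + e) sequentially"
  shows "d v \<le> c"
proof (rule field_le_epsilon)
  fix e :: real assume "0 < e"
  have "eventually (\<lambda>n. u n \<bullet> g \<le> c + e - d v + v \<bullet> g) sequentially"
    using le[OF \<open>0 < e\<close>]
  proof eventually_elim
    case (elim n)
    then show ?case using subgrad[of "u n"] by (simp add: inner_diff_left)
  qed
  then show "d v \<le> c + e" using tail_hull_point_le[OF v] by fastforce
qed

text \<open>Opial's lemma. If $\langle u_n,h\rangle$ stayed away from $\langle z,h\rangle$ along a subsequence,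
the subsequence would have its own tail hull point $v \in S$. Since $\|u_n - z\|^2$ and $\|u_n-v\|^2$
converge, so does $\langle u_n,z-v\rangle$, and its limit is both $\langle z,z-v\rangle$ and
$\langle v,z-v\rangle$, whence $v = z$.\<close>

lemma opial:
  fixes u :: "nat \<Rightarrow> 'a::{real_inner,complete_space}"
  assumes bdd: "bounded (range u)"
    and conv: "\<And>s. s \<in> S \<Longrightarrow> convergent (\<lambda>n. (norm (u n - s))\<^sup>2)"
    and S: "\<And>v. tail_hull_point u v \<Longrightarrow> v \<in> S"
  shows "\<exists>z\<in>S. weakly_tendsto u z"
proof -
  obtain z where z: "tail_hull_point u z" using tail_hull_point_exists[OF bdd] .
  have no_gap: False if "0 < e" and inf: "infinite {n. z \<bullet> h + e \<le> u n \<bullet> h}" for h e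
  proof -
    obtain r :: "nat \<Rightarrow> nat" where r: "strict_mono r" "\<And>n. z \<bullet> h + e \<le> u (r n) \<bullet> h"
      using infinite_enumerate[OF inf] unfolding mem_Collect_eq by metis
    have "bounded (range (u \<circ> r))" by (rule bounded_subset[OF bdd]) auto
    then obtain v where v: "tail_hull_point (u \<circ> r) v" using tail_hull_point_exists by blast
    have vS: "v \<in> S" "z \<in> S" using S z tail_hull_point_subseq[OF r(1) v] by auto
    obtain a b where a: "(\<lambda>n. (norm (u n - v))\<^sup>2) \<longlonglongrightarrow> a" and b: "(\<lambda>n. (norm (u n - z))\<^sup>2) \<longlonglongrightarrow> b"
      using conv vS unfolding convergent_def by meson
    have "(\<lambda>n. ((norm (u n - v))\<^sup>2 - (norm (u n - z))\<^sup>2 + (norm z)\<^sup>2 - (norm v)\<^sup>2) / 2)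
      \<longlonglongrightarrow> (a - b + (norm z)\<^sup>2 - (norm v)\<^sup>2) / 2" by (intro tendsto_intros a b) simp
    moreover have "((norm (u n - v))\<^sup>2 - (norm (u n - z))\<^sup>2 + (norm z)\<^sup>2 - (norm v)\<^sup>2) / 2
        = u n \<bullet> (z - v)" for n
      by (simp add: power2_norm_eq_inner inner_simps inner_commute)
    ultimately have lim: "(\<lambda>n. u n \<bullet> (z - v)) \<longlonglongrightarrow> (a - b + (norm z)\<^sup>2 - (norm v)\<^sup>2) / 2" by simp
    then have "(\<lambda>n. (u \<circ> r) n \<bullet> (z - v)) \<longlonglongrightarrow> (a - b + (norm z)\<^sup>2 - (norm v)\<^sup>2) / 2"
      using LIMSEQ_subseq_LIMSEQ[OF _ r(1), of "\<lambda>n. u n \<bullet> (z - v)"] by (simp add: comp_def)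
    then have "z \<bullet> (z - v) = v \<bullet> (z - v)"
      using tail_hull_point_lim[OF z lim] tail_hull_point_lim[OF v] by simp
    then have "(z - v) \<bullet> (z - v) = 0" by (simp add: inner_diff_left)
    then have "z = v" by simp
    have "z \<bullet> h + e \<le> v \<bullet> h" by (rule tail_hull_point_ge[OF v]) (simp add: r(2))
    then show False using \<open>z = v\<close> \<open>0 < e\<close> by simp
  qed
  have ev: "eventually (\<lambda>n. u n \<bullet> h < z \<bullet> h + e) sequentially" if "0 < e" for h e
  proof -
    have "finite {n. z \<bullet> h + e \<le> u n \<bullet> h}" using no_gap[OF that] by blast
    then show ?thesis
      by (simp add: eventually_cofinite cofinite_eq_sequentially[symmetric] not_less)
  qed
  have "(\<lambda>n. u n \<bullet> h) \<longlonglongrightarrow> z \<bullet> h" for h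
  proof (rule LIMSEQ_I)
    fix e :: real assume "0 < e"
    have "eventually (\<lambda>n. norm (u n \<bullet> h - z \<bullet> h) < e) sequentially"
      using ev[OF \<open>0 < e\<close>, of h] ev[OF \<open>0 < e\<close>, of "- h"] by eventually_elim (simp add: abs_less_iff)
    then show "\<exists>N. \<forall>n\<ge>N. norm (u n \<bullet> h - z \<bullet> h) < e" by (simp add: eventually_sequentially)
  qed
  then show ?thesis using S[OF z] by (auto simp: weakly_tendsto_def)
qed

section \<open>Descent inequalities for real sequences\<close>

text \<open>Subtracting the partial sums of the errors leaves a decreasing sequence that is bounded below.\<close>

lemma quasi_fejer_convergent:
  fixes a e :: "nat \<Rightarrow> real"
  assumes "\<And>n. 0 \<le> a n" "\<And>n. 0 \<le> e n" "summable e" "\<And>n. a (Suc n) \<le> a n + e n"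
  shows "convergent a"
proof -
  define b where "b n = a n - (\<Sum>k<n. e k)" for n
  have "decseq b" unfolding b_def by (rule decseq_SucI) (use assms(4) in \<open>simp add: algebra_simps\<close>)
  moreover have "- suminf e \<le> b n" for n
    using sum_le_suminf[OF assms(3), of "{..<n}"] assms(1)[of n] assms(2) by (simp add: b_def)
  ultimately obtain l where "b \<longlonglongrightarrow> l" using decseq_convergent by metis
  then have "(\<lambda>n. b n + (\<Sum>k<n. e k)) \<longlonglongrightarrow> l + suminf e"
    by (rule tendsto_add[OF _ summable_LIMSEQ[OF assms(3)]])
  then show ?thesis by (auto simp: b_def convergent_def)
qed

text \<open>The terms $a_n$ telescope; since the values decrease, the last of them is at most their mean.\<close>

lemma descent_rate:
  fixes val a e :: "nat \<Rightarrow> real"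
  assumes "decseq val" "\<And>n. 0 \<le> a n" "\<And>n. 0 \<le> e n" "summable e"
    and step: "\<And>n. val n + a (Suc n) \<le> c + a n + e n"
  shows "(\<Sum>k<n. val k - c) \<le> a 0 + suminf e"
    and "real (Suc n) * (val n - c) \<le> a 0 + suminf e"
proof -
  have *: "(\<Sum>k<n. val k - c) + a n \<le> a 0 + (\<Sum>k<n. e k)" for n
  proof (induction n)
    case (Suc n)
    then show ?case using step[of n] by simp
  qed simp
  then have sum: "(\<Sum>k<n. val k - c) \<le> a 0 + suminf e" for n
  proof -
    have "(\<Sum>k<n. e k) \<le> suminf e" by (rule sum_le_suminf[OF assms(4)]) (use assms(3) in auto)
    then show ?thesis using *[of n] assms(2)[of n] by linarith
  qed
  then show "(\<Sum>k<n. val k - c) \<le> a 0 + suminf e" .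
  have "(\<Sum>k<Suc n. val n - c) \<le> (\<Sum>k<Suc n. val k - c)"
    by (rule sum_mono) (use decseqD[OF assms(1)] in auto)
  then show "real (Suc n) * (val n - c) \<le> a 0 + suminf e" using sum[of "Suc n"] by simp
qed

text \<open>For $n \ge 2M$ at least half of the indices below $n$ are at least $M$, and each of their terms is at
least $b_n$; the corresponding block sum is small by the Cauchy criterion.\<close>

lemma decseq_summable_o:
  fixes b :: "nat \<Rightarrow> real"
  assumes "decseq b" "\<And>n. 0 \<le> b n" "summable b"
  shows "(\<lambda>n. real n * b n) \<longlonglongrightarrow> 0"
proof (rule LIMSEQ_I)
  fix e :: real assume "0 < e"
  then obtain M where M: "\<And>m n. M \<le> m \<Longrightarrow> norm (sum b {m..<n}) < e / 2"
    using assms(3)[unfolded summable_Cauchy, rule_format, of "e / 2"] by auto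
  have "norm (real n * b n - 0) < e" if "2 * M \<le> n" for n
  proof -
    have "real n * b n \<le> (2 * real (n - M)) * b n"
      using that assms(2) by (intro mult_right_mono) auto
    also have "\<dots> = 2 * (\<Sum>k\<in>{M..<n}. b n)" using that by simp
    also have "\<dots> \<le> 2 * sum b {M..<n}"
      by (intro mult_left_mono sum_mono) (use decseqD[OF assms(1)] in auto)
    also have "\<dots> < e" using M[of M n] by simp
    finally show ?thesis using assms(2)[of n] by simp
  qed
  then show "\<exists>no. \<forall>n\<ge>no. norm (real n * b n - 0) < e" by blast
qed

text \<open>The shift accounts for the fact that the value obtained in step $n$ controls the iterate $n+1$.\<close>

lemma rate_smallo:
  fixes b X :: "nat \<Rightarrow> real"
  assumes b: "(\<lambda>n. real n * b n) \<longlonglongrightarrow> 0" "b \<longlonglongrightarrow> 0"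
    and X: "\<And>n. 0 \<le> X n" "\<And>n. (X (Suc n))\<^sup>2 \<le> b n"
  shows "X \<in> o(\<lambda>n. real n powr (- 1 / 2))" "X \<longlonglongrightarrow> 0"
proof -
  have lim: "(\<lambda>n. real n * b n + b n) \<longlonglongrightarrow> 0 + 0" by (intro tendsto_intros b)
  show o: "X \<in> o(\<lambda>n. real n powr (- 1 / 2))"
  proof (rule landau_o.smallI)
    fix c :: real assume c: "0 < c"
    have "eventually (\<lambda>n. real n * b n + b n < c\<^sup>2) sequentially"
      using c by (intro order_tendstoD(2)[OF lim]) simp
    then have "eventually (\<lambda>n. norm (X (Suc n)) \<le> c * norm (real (Suc n) powr (- 1 / 2))) sequentially"
    proof eventually_elim
      case (elim n)
      have "(real n + 1) * b n < c\<^sup>2" using elim by (simp add: algebra_simps)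
      then have "b n \<le> c\<^sup>2 / (real n + 1)" by (simp add: field_simps)
      then have "(X (Suc n))\<^sup>2 \<le> c\<^sup>2 / (real n + 1)" using X(2)[of n] by linarith
      also have "\<dots> = (c / sqrt (real (Suc n)))\<^sup>2" by (simp add: power_divide)
      finally have "X (Suc n) \<le> c / sqrt (real (Suc n))" by (rule power2_le_imp_le) (use c in simp)
      then show ?case using X(1)[of "Suc n"]
        by (simp add: powr_minus_divide powr_half_sqrt del: of_nat_Suc)
    qed
    then show "eventually (\<lambda>n. norm (X n) \<le> c * norm (real n powr (- 1 / 2))) sequentially"
      by (subst eventually_sequentially_Suc[symmetric])
  qed
  have "eventually (\<lambda>n. norm (X n) \<le> real n powr (- 1 / 2)) sequentially"
    using landau_o.smallD[OF o, of 1] by simp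
  moreover have "(\<lambda>n. real n powr (- 1 / 2)) \<longlonglongrightarrow> 0"
    by (rule tendsto_neg_powr[OF _ filterlim_real_sequentially]) simp
  ultimately show "X \<longlonglongrightarrow> 0" by (rule Lim_null_comparison)
qed

section \<open>The conjugate of a conditioning modulus\<close>

text \<open>The Cauchy-Schwarz inequality reduces the conjugate of $v \mapsto m(\|v-y\|)$ to that of $m$.\<close>

lemma conj_fun_le_modulus:
  fixes f :: "'a::real_inner \<Rightarrow> ereal"
  assumes "\<And>v. m (norm (v - y)) \<le> f v"
  shows "conj_fun f u \<le> ereal (y \<bullet> u) + conj_fun m (norm u)"
proof (rule conj_fun_leI)
  fix v
  have "ereal (norm (v - y) \<bullet> norm u) - m (norm (v - y)) \<le> conj_fun m (norm u)" by (rule fenchel_young)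
  moreover have "v \<bullet> u \<le> y \<bullet> u + norm (v - y) * norm u"
    using norm_cauchy_schwarz[of "v - y" u] by (simp add: inner_diff_left)
  ultimately show "ereal (v \<bullet> u) - f v \<le> ereal (y \<bullet> u) + conj_fun m (norm u)"
    using assms[of v]
    by (cases "m (norm (v - y))"; cases "f v"; cases "conj_fun m (norm u)") auto
qed

lemma conj_fun_even_mono:
  fixes m :: "real \<Rightarrow> ereal"
  assumes even: "\<And>t. m (- t) = m t" and s: "0 \<le> s" "s \<le> s'"
  shows "conj_fun m s \<le> conj_fun m s'"
proof (rule conj_fun_leI)
  fix t
  have "m \<bar>t\<bar> = m t" using even[of t] by (simp add: abs_if)
  moreover have "t * s \<le> \<bar>t\<bar> * s'"
    using mult_mono[of t "\<bar>t\<bar>" s s'] s by simp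
  ultimately have "ereal (t \<bullet> s) - m t \<le> ereal (\<bar>t\<bar> \<bullet> s') - m \<bar>t\<bar>"
    by (cases "m t") auto
  also have "\<dots> \<le> conj_fun m s'" by (rule fenchel_young)
  finally show "ereal (t \<bullet> s) - m t \<le> conj_fun m s'" .
qed

lemma conj_fun_nonneg: "m 0 = 0 \<Longrightarrow> 0 \<le> conj_fun m s"
  using fenchel_young[of 0 s m] by (simp flip: zero_ereal_def)

text \<open>Close to $0$ the modulus dominates $\frac\gamma p|t|^p$, and the bound is Young's inequality with an
unoptimised constant. Away from $0$ the only information is convexity with $m(0) = 0$: there $m$
grows at least linearly with slope $s_0$, so these arguments contribute nothing when $s \le s_0$.
For $p = 1$ the linear growth holds everywhere and the conjugate vanishes near $0$. The exponent
$1/(p-1)$ is then $1/0 = 0$, hence the separate clause on $c$.\<close>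

lemma conj_modulus_bound:
  fixes m :: "real \<Rightarrow> ereal"
  assumes m: "m \<in> Gamma0" "\<And>t. 0 \<le> m t" "m 0 = 0" and p: "1 \<le> p"
    and \<epsilon>: "0 < \<epsilon>" and \<gamma>: "0 < \<gamma>"
    and wc: "\<And>t. t \<in> {-\<epsilon><..<\<epsilon>} \<Longrightarrow> ereal (\<gamma> / p * \<bar>t\<bar> powr p) \<le> m t"
  obtains s0 c where "0 < s0" "0 \<le> c" "p = 1 \<Longrightarrow> c = 0"
    "\<And>s. 0 \<le> s \<Longrightarrow> s \<le> s0 \<Longrightarrow> conj_fun m s \<le> ereal (c * (s * s powr (1 / (p - 1))))"
proof -
  define \<delta> where "\<delta> = \<epsilon> / 2"
  have \<delta>: "0 < \<delta>" "\<delta> < \<epsilon>" using \<epsilon> by (auto simp: \<delta>_def)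
  define s0 where "s0 = \<gamma> / p * \<delta> powr (p - 1)"
  define c where "c = (if p = 1 then 0 else (p / \<gamma>) powr (1 / (p - 1)))"
  have s0: "0 < s0" using \<gamma> p \<delta> by (simp add: s0_def)
  have far: "ereal (s0 * t) \<le> m t" if t: "\<delta> \<le> t" for t
  proof (cases "m t")
    case (real b)
    have \<delta>m: "ereal (s0 * \<delta>) \<le> m \<delta>"
      using wc[of \<delta>] \<delta> by (simp add: s0_def powr_diff)
    show ?thesis
    proof (cases "t = \<delta>")
      case False
      \<comment> \<open>Convexity on the segment from $0$ to $t$, which contains $\delta$.\<close>
      define r where "r = \<delta> / t"
      have r: "0 < r" "r < 1" "r * t = \<delta>" using t \<delta> False by (auto simp: r_def)
      obtain k where "m \<delta> = ereal k" "k \<le> r * b"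
        using Gamma0_convex_real[OF m(1), of 0 0 t b r] r real m(3) by (auto simp: zero_ereal_def)
      then have "s0 * (r * t) \<le> r * b" using \<delta>m r by simp
      then have "r * (s0 * t) \<le> r * b" by (simp add: mult.left_commute)
      then show ?thesis using r real by simp
    qed (use \<delta>m in simp)
  qed (use m(2)[of t] in auto)
  have "conj_fun m s \<le> ereal (c * (s * s powr (1 / (p - 1))))" if s: "0 \<le> s" "s \<le> s0" for s
  proof (rule conj_fun_leI)
    fix t
    let ?B = "c * (s * s powr (1 / (p - 1)))"
    have B: "0 \<le> ?B" using s p \<gamma> by (simp add: c_def)
    have dom: "ereal (t \<bullet> s) - m t \<le> ereal ?B" if "ereal (t * s) \<le> m t"
      using that B by (cases "m t") auto
    consider "t \<le> 0" | "\<delta> \<le> t" | "0 < t" "t < \<delta>" by linarith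
    then show "ereal (t \<bullet> s) - m t \<le> ereal ?B"
    proof cases
      case 1
      then have "ereal (t * s) \<le> 0" using s by (simp add: mult_nonpos_nonneg)
      then show ?thesis using dom m(2)[of t] order_trans by blast
    next
      case 2
      then have "t * s \<le> s0 * t" using s \<delta> by (simp add: mult.commute mult_right_mono)
      then have "ereal (t * s) \<le> ereal (s0 * t)" by simp
      then show ?thesis using dom far[OF 2] order_trans by blast
    next
      case 3
      then have mt: "ereal (\<gamma> / p * t powr p) \<le> m t" using wc[of t] \<delta> by simp
      \<comment> \<open>Either the power term already dominates $ts$, or it does not, and then $t$ itself is small.\<close>
      have tp: "t powr p = t * t powr (p - 1)" using 3 by (simp add: powr_diff)
      show ?thesis
      proof (cases "s \<le> \<gamma> / p * t powr (p - 1)")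
        case True
        then have "t * s \<le> t * (\<gamma> / p * t powr (p - 1))" using 3 by (intro mult_left_mono) auto
        then have "t * s \<le> \<gamma> / p * t powr p" by (simp only: tp mult.left_commute)
        then have "ereal (t * s) \<le> ereal (\<gamma> / p * t powr p)" by simp
        then show ?thesis using dom mt order_trans by blast
      next
        case False
        have p1: "p \<noteq> 1"
        proof
          assume "p = 1"
          then show False using False s 3 \<delta> by (simp add: s0_def)
        qed
        have "t powr (p - 1) \<le> p / \<gamma> * s" using False \<gamma> p by (simp add: field_simps)
        then have "(t powr (p - 1)) powr (1 / (p - 1)) \<le> (p / \<gamma> * s) powr (1 / (p - 1))"
          using p by (intro powr_mono2) auto
        moreover have "(t powr (p - 1)) powr (1 / (p - 1)) = t" using p1 3 by (simp add: powr_powr)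
        moreover have "(p / \<gamma> * s) powr (1 / (p - 1)) = c * s powr (1 / (p - 1))"
          using p1 p \<gamma> s unfolding c_def by (subst powr_mult) auto
        ultimately have "t \<le> c * s powr (1 / (p - 1))" by simp
        then have "t * s \<le> c * s powr (1 / (p - 1)) * s" using s(1) by (rule mult_right_mono)
        then have "t * s \<le> ?B" by (simp only: ac_simps)
        then show ?thesis using m(2)[of t] by (cases "m t") auto
      qed
    qed
  qed
  moreover have "0 \<le> c" "p = 1 \<Longrightarrow> c = 0" by (auto simp: c_def)
  ultimately show ?thesis using that[OF s0] by blast
qed

text \<open>With $r = \|z\|$ the quotients bound the error of replacing $\lambda_n^{-1}D^*(\lambda_n z)$ by its
limit; they are of order $\lambda_n^{1/(p-1)}$. Finitely many terms may be infinite; their real values are arbitrary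
and do not affect summability.\<close>

lemma conj_modulus_summable:
  fixes m :: "real \<Rightarrow> ereal" and l :: "nat \<Rightarrow> real"
  assumes m: "m \<in> Gamma0" "\<And>t. 0 \<le> m t" "m 0 = 0" and p: "1 \<le> p"
    and \<epsilon>: "0 < \<epsilon>" and \<gamma>: "0 < \<gamma>"
    and wc: "\<And>t. t \<in> {-\<epsilon><..<\<epsilon>} \<Longrightarrow> ereal (\<gamma> / p * \<bar>t\<bar> powr p) \<le> m t"
    and l: "\<And>n. 0 < l n" "l \<longlonglongrightarrow> 0"
    and summ: "p > 1 \<Longrightarrow> summable (\<lambda>n. l n powr (1 / (p - 1)))"
    and r: "0 \<le> r"
  shows "eventually (\<lambda>n. conj_fun m (r * l n) < \<infinity>) sequentially"
    "summable (\<lambda>n. real_of_ereal (conj_fun m (r * l n)) / l n)"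
proof -
  obtain s0 c where s0: "0 < s0" and c: "0 \<le> c" "p = 1 \<Longrightarrow> c = 0" and
    bound: "\<And>s. 0 \<le> s \<Longrightarrow> s \<le> s0 \<Longrightarrow> conj_fun m s \<le> ereal (c * (s * s powr (1 / (p - 1))))"
    using conj_modulus_bound[OF m p \<epsilon> \<gamma> wc] by metis
  have "(\<lambda>n. r * l n) \<longlonglongrightarrow> r * 0" by (intro tendsto_intros l(2))
  then have "eventually (\<lambda>n. r * l n < s0) sequentially" using s0 by (intro order_tendstoD) auto
  then have ev: "eventually (\<lambda>n. conj_fun m (r * l n) \<le> ereal (c * (r * l n * (r * l n) powr (1 / (p - 1))))) sequentially"
  proof eventually_elim
    case (elim n)
    then show ?case using r l(1)[of n] by (intro bound) auto
  qed
  then show "eventually (\<lambda>n. conj_fun m (r * l n) < \<infinity>) sequentially"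
    by (rule eventually_mono) auto
  have sum: "summable (\<lambda>n. c * (r * r powr (1 / (p - 1))) * l n powr (1 / (p - 1)))"
  proof (cases "p = 1")
    case True
    then show ?thesis using c(2) by simp
  next
    case False
    then show ?thesis using p by (intro summable_mult summ) auto
  qed
  show "summable (\<lambda>n. real_of_ereal (conj_fun m (r * l n)) / l n)"
  proof (rule summable_comparison_test_ev[OF _ sum], use ev in eventually_elim)
    case (elim n)
    have nn: "0 \<le> conj_fun m (r * l n)" by (rule conj_fun_nonneg[of m, OF m(3)])
    then have "real_of_ereal (conj_fun m (r * l n)) \<le> c * (r * l n * (r * l n) powr (1 / (p - 1)))"
      using elim by (cases "conj_fun m (r * l n)") auto
    then have "real_of_ereal (conj_fun m (r * l n)) / l n
        \<le> c * (r * l n * (r * l n) powr (1 / (p - 1))) / l n"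
      using l(1)[of n] by (intro divide_right_mono) auto
    also have "\<dots> = c * (r * r powr (1 / (p - 1))) * l n powr (1 / (p - 1))"
      using l(1)[of n] r by (simp add: powr_mult)
    finally show ?case using nn l(1)[of n] by (simp add: real_of_ereal_pos)
  qed
qed

section \<open>The dual forward-backward step\<close>

text \<open>A gradient step of length $1/(M+1)$ would otherwise decrease the function.\<close>

lemma minimizer_gradient_zero:
  fixes d :: "'a::real_inner \<Rightarrow> real"
  assumes min: "\<And>y. d z \<le> d y" and M: "0 \<le> M"
    and up: "\<And>y. d y \<le> d z + g \<bullet> (y - z) + M / 2 * (norm (y - z))\<^sup>2"
  shows "g = 0"
proof -
  define t where "t = 1 / (M + 1)"
  have t: "0 < t" "t * M \<le> 1" using M by (auto simp: t_def)
  have "0 \<le> - t * (norm g)\<^sup>2 + M / 2 * (t * norm g)\<^sup>2"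
    using min[of "z - t *\<^sub>R g"] up[of "z - t *\<^sub>R g"] t by (simp add: power2_norm_eq_inner)
  also have "\<dots> = - t * (1 - t * M / 2) * (norm g)\<^sup>2" by (simp add: power2_eq_square algebra_simps)
  finally have "t * (1 - t * M / 2) * (norm g)\<^sup>2 \<le> 0" by simp
  moreover have "0 < t * (1 - t * M / 2) * (norm g)\<^sup>2" if "g \<noteq> 0"
    using t that by (intro mult_pos_pos) auto
  ultimately show ?thesis by force
qed

text \<open>The standard inequality for one explicit step on $F$ followed by an implicit one, where $q$ is a
subgradient of the implicit term at the new point, $c$ its value there and $b$ an upper bound of its
value at $z$. The
stepsize condition absorbs the quadratic error of the explicit step.\<close>

lemma forward_backward_step:
  fixes F :: "'a::real_inner \<Rightarrow> real"
  assumes low: "F u + g \<bullet> (z - u) \<le> F z"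
    and up: "F u' \<le> F u + g \<bullet> (u' - u) + L / 2 * (norm (u' - u))\<^sup>2"
    and G: "c + q \<bullet> (z - u') \<le> b"
    and u': "u' = u - \<tau> *\<^sub>R (g + q)" and \<tau>: "0 < \<tau>" "\<tau> * L \<le> 1"
  shows "F u' + c + (norm (u' - z))\<^sup>2 / (2 * \<tau>) \<le> F z + b + (norm (u - z))\<^sup>2 / (2 * \<tau>)"
proof -
  have "u - u' = \<tau> *\<^sub>R (g + q)" by (simp add: u')
  then have "(u - u') \<bullet> (z - u') = \<tau> * (g \<bullet> (z - u') + q \<bullet> (z - u'))" by (simp add: inner_add_left)
  moreover have "(norm (u - z))\<^sup>2 = (norm (u' - u))\<^sup>2 + (norm (u' - z))\<^sup>2 - 2 * ((u - u') \<bullet> (z - u'))"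
    by (simp add: power2_norm_eq_inner inner_simps inner_commute)
  ultimately have "(norm (u - z))\<^sup>2 / (2 * \<tau>) = (norm (u' - u))\<^sup>2 / (2 * \<tau>) + (norm (u' - z))\<^sup>2 / (2 * \<tau>)
      - (g \<bullet> (z - u') + q \<bullet> (z - u'))"
    using \<tau> by (simp add: diff_divide_distrib add_divide_distrib)
  moreover have "L / 2 * (norm (u' - u))\<^sup>2 \<le> (norm (u' - u))\<^sup>2 / (2 * \<tau>)"
  proof -
    have "L / 2 \<le> 1 / (2 * \<tau>)" using \<tau> by (simp add: field_simps)
    then have "L / 2 * (norm (u' - u))\<^sup>2 \<le> 1 / (2 * \<tau>) * (norm (u' - u))\<^sup>2" by (rule mult_right_mono) simp
    then show ?thesis by simp
  qed
  moreover have "g \<bullet> (z - u) = g \<bullet> (z - u') + g \<bullet> (u' - u)" by (simp add: inner_diff_right)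
  ultimately show ?thesis using low up G by linarith
qed

text \<open>Moreau's decomposition: the proximal point of $\phi$ is a subgradient of $\phi^*$ at $\rho u'$, so
the update is a backward step on $\rho^{-1}\phi^*(\rho\,\cdot)$. The step is stated for upper bounds
$a$ of $\rho^{-1}(\Psi+\phi^*)(\rho z)$, since this quantity may be infinite; at the new point it is
finite and equal to $b$.\<close>

lemma dual_diagonal_step:
  fixes h \<Psi> :: "'b::{real_inner,complete_space} \<Rightarrow> real" and \<phi> :: "'b \<Rightarrow> ereal"
  assumes \<rho>: "0 < \<rho>" and \<sigma>: "0 < \<sigma>" and \<phi>: "\<phi> \<in> Gamma0"
    and \<tau>: "0 < \<tau>" "\<tau> * (M + \<rho> / \<sigma>) \<le> 1"
    and h: "\<And>z. h u + gh \<bullet> (z - u) \<le> h z"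
      "\<And>z. h z \<le> h u + gh \<bullet> (z - u) + M / 2 * (norm (z - u))\<^sup>2"
    and \<Psi>: "\<And>v. \<Psi> (\<rho> *\<^sub>R u) + g\<Psi> \<bullet> (v - \<rho> *\<^sub>R u) \<le> \<Psi> v"
      "\<And>v. \<Psi> v \<le> \<Psi> (\<rho> *\<^sub>R u) + g\<Psi> \<bullet> (v - \<rho> *\<^sub>R u) + (norm (v - \<rho> *\<^sub>R u))\<^sup>2 / (2 * \<sigma>)"
    and w: "w = u - \<tau> *\<^sub>R gh - \<tau> *\<^sub>R g\<Psi>"
    and u': "u' = w - \<tau> *\<^sub>R prox (\<lambda>v. ereal (1 / (\<tau> * \<rho>)) * \<phi> v) ((1 / \<tau>) *\<^sub>R w)"
  obtains b where "ereal (\<Psi> (\<rho> *\<^sub>R u')) + conj_fun \<phi> (\<rho> *\<^sub>R u') = ereal (\<rho> * b)"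
    "\<And>z a. ereal (\<Psi> (\<rho> *\<^sub>R z)) + conj_fun \<phi> (\<rho> *\<^sub>R z) \<le> ereal (\<rho> * a) \<Longrightarrow>
      h u' + b + (norm (u' - z))\<^sup>2 / (2 * \<tau>) \<le> h z + a + (norm (u - z))\<^sup>2 / (2 * \<tau>)"
proof -
  define q where "q = prox (\<lambda>v. ereal (1 / (\<tau> * \<rho>)) * \<phi> v) ((1 / \<tau>) *\<^sub>R w)"
  have "0 < 1 / (\<tau> * \<rho>)" using \<tau> \<rho> by simp
  then obtain \<beta> where \<beta>: "\<phi> q = ereal \<beta>" and "(1 / (1 / (\<tau> * \<rho>))) *\<^sub>R ((1 / \<tau>) *\<^sub>R w - q) \<in> subdiff \<phi> q"
    using prox_subgradient[OF \<phi>] unfolding q_def by metis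
  moreover have "(1 / (1 / (\<tau> * \<rho>))) *\<^sub>R ((1 / \<tau>) *\<^sub>R w - q) = \<rho> *\<^sub>R u'"
    unfolding u' q_def[symmetric] using \<tau>(1) by (simp add: scaleR_diff_right mult.commute)
  ultimately have "\<rho> *\<^sub>R u' \<in> subdiff \<phi> q" by simp
  then have conj: "conj_fun \<phi> (\<rho> *\<^sub>R u') = ereal (q \<bullet> (\<rho> *\<^sub>R u') - \<beta>)" using \<beta> by (rule subdiff_conj_fun)
  define F where "F z = h z + \<Psi> (\<rho> *\<^sub>R z) / \<rho>" for z
  define c where "c = (q \<bullet> (\<rho> *\<^sub>R u') - \<beta>) / \<rho>"
  have scale: "\<rho> *\<^sub>R y - \<rho> *\<^sub>R z = \<rho> *\<^sub>R (y - z)" for y z :: 'b by (simp add: scaleR_diff_right)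
  have low: "F u + (gh + g\<Psi>) \<bullet> (z - u) \<le> F z" for z
  proof -
    have "(\<Psi> (\<rho> *\<^sub>R u) + \<rho> * (g\<Psi> \<bullet> (z - u))) / \<rho> \<le> \<Psi> (\<rho> *\<^sub>R z) / \<rho>"
      using \<Psi>(1)[of "\<rho> *\<^sub>R z"] \<rho> unfolding scale by (intro divide_right_mono) auto
    then show ?thesis using h(1)[of z] \<rho> by (simp add: F_def inner_add_left add_divide_distrib)
  qed
  have up: "F z \<le> F u + (gh + g\<Psi>) \<bullet> (z - u) + (M + \<rho> / \<sigma>) / 2 * (norm (z - u))\<^sup>2" for z
  proof -
    have "\<Psi> (\<rho> *\<^sub>R z) / \<rho> \<le> (\<Psi> (\<rho> *\<^sub>R u) + \<rho> * (g\<Psi> \<bullet> (z - u)) + (\<rho> * norm (z - u))\<^sup>2 / (2 * \<sigma>)) / \<rho>"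
      using \<Psi>(2)[of "\<rho> *\<^sub>R z"] \<rho> unfolding scale by (intro divide_right_mono) auto
    also have "\<dots> = \<Psi> (\<rho> *\<^sub>R u) / \<rho> + g\<Psi> \<bullet> (z - u) + \<rho> / \<sigma> / 2 * (norm (z - u))\<^sup>2"
      using \<rho> \<sigma> by (simp add: field_simps power2_eq_square)
    finally show ?thesis
      using h(2)[of z] unfolding F_def inner_add_left add_divide_distrib distrib_right by linarith
  qed
  define b where "b = \<Psi> (\<rho> *\<^sub>R u') / \<rho> + c"
  have step: "h u' + b + (norm (u' - z))\<^sup>2 / (2 * \<tau>) \<le> h z + a + (norm (u - z))\<^sup>2 / (2 * \<tau>)"
    if le: "ereal (\<Psi> (\<rho> *\<^sub>R z)) + conj_fun \<phi> (\<rho> *\<^sub>R z) \<le> ereal (\<rho> * a)" for z a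
  proof -
    have "ereal (q \<bullet> (\<rho> *\<^sub>R z) - \<beta>) \<le> conj_fun \<phi> (\<rho> *\<^sub>R z)"
      using fenchel_young[of q "\<rho> *\<^sub>R z" \<phi>] \<beta> by simp
    then have "\<Psi> (\<rho> *\<^sub>R z) + (q \<bullet> (\<rho> *\<^sub>R z) - \<beta>) \<le> \<rho> * a"
      using le by (cases "conj_fun \<phi> (\<rho> *\<^sub>R z)") auto
    then have "(\<Psi> (\<rho> *\<^sub>R z) + (q \<bullet> (\<rho> *\<^sub>R z) - \<beta>)) / \<rho> \<le> a" using \<rho> by (simp add: field_simps)
    then have "c + q \<bullet> (z - u') \<le> a - \<Psi> (\<rho> *\<^sub>R z) / \<rho>"
      using \<rho> by (simp add: c_def inner_diff_right diff_divide_distrib add_divide_distrib)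
    moreover have "u' = u - \<tau> *\<^sub>R ((gh + g\<Psi>) + q)"
      unfolding u' q_def[symmetric] unfolding w by (simp add: scaleR_add_right)
    ultimately have "F u' + c + (norm (u' - z))\<^sup>2 / (2 * \<tau>)
        \<le> F z + (a - \<Psi> (\<rho> *\<^sub>R z) / \<rho>) + (norm (u - z))\<^sup>2 / (2 * \<tau>)"
      using forward_backward_step[of F u "gh + g\<Psi>" z u' "M + \<rho> / \<sigma>", OF low up] \<tau> by blast
    then show ?thesis by (simp add: F_def b_def)
  qed
  have "ereal (\<Psi> (\<rho> *\<^sub>R u')) + conj_fun \<phi> (\<rho> *\<^sub>R u') = ereal (\<rho> * b)"
    unfolding conj b_def c_def using \<rho> by (simp add: field_simps)
  then show ?thesis using that step by blast
qed

section \<open>Convergence of the diagonal dual descent method\<close>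

theorem theorem5p1:
  fixes A :: "'a::{real_inner,complete_space} \<Rightarrow> 'b::{real_inner,complete_space}"
    and R :: "'a \<Rightarrow> ereal"
    and D \<psi> \<phi> :: "'b \<Rightarrow> 'b \<Rightarrow> ereal"
    and mbar :: "real \<Rightarrow> ereal"
    and xbar xdag :: 'a and ybar :: 'b
    and p \<sigma>\<^sub>\<psi> \<sigma>\<^sub>R \<tau> L :: real
    and lam :: "nat \<Rightarrow> real"
    and x :: "nat \<Rightarrow> 'a" and w u :: "nat \<Rightarrow> 'b"
  assumes A: "bounded_linear A" and xbar: "A xbar = ybar"
    and AD1: "\<And>v y. 0 \<le> D v y" "\<And>v y. D v y = 0 \<longleftrightarrow> v = y"
    and AD2: "0 < \<sigma>\<^sub>\<psi>"
      "\<And>y. (\<lambda>v. D v y) = inf_conv (\<psi> y) (\<phi> y)"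
      "\<And>y. \<phi> y \<in> Gamma0"
      "\<And>y. \<exists>J\<in>Gamma0. \<psi> y = (\<lambda>v. J v + ereal (\<sigma>\<^sub>\<psi> / 2 * (norm v)\<^sup>2))"
    and AD3: "coercive (\<lambda>v. D v ybar)" "1 \<le> p" "well_conditioned p (\<lambda>v. D v ybar) mbar"
    and AR1: "0 < \<sigma>\<^sub>R" "strongly_convex \<sigma>\<^sub>R R"
    and AR2: "xbar \<in> edom R"
    and lam: "\<And>n. 0 < lam n" "decseq lam" "lam \<longlonglongrightarrow> 0"
    and L: "L = (onorm A)\<^sup>2 / \<sigma>\<^sub>R + lam 0 / \<sigma>\<^sub>\<psi>"
    and tau: "0 < \<tau>" "\<tau> \<le> 1 / L"
    and x_step: "\<And>n. x n = grad (conj_fun R) (- adjoint A (u n))"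
    and w_step: "\<And>n. w (Suc n) =
        u n + \<tau> *\<^sub>R A (x n) - \<tau> *\<^sub>R grad (conj_fun (\<psi> ybar)) (lam n *\<^sub>R u n)"
    and u_step: "\<And>n. u (Suc n) = w (Suc n) -
        \<tau> *\<^sub>R prox (\<lambda>v. ereal (1 / (\<tau> * lam n)) * \<phi> ybar v) ((1 / \<tau>) *\<^sub>R w (Suc n))"
    and lam_summable: "p > 1 \<Longrightarrow> summable (\<lambda>n. lam n powr (1 / (p - 1)))"
    and xdag: "is_arg_min R (\<lambda>z. z \<in> argmin_set (\<lambda>x'. D (A x') ybar)) xdag"
  shows
    "(subdiff R xdag \<inter> range (adjoint A) \<noteq> {} \<longleftrightarrow> argmin_set (dual_objective R A ybar) \<noteq> {}) \<and>
     (argmin_set (dual_objective R A ybar) \<noteq> {} \<longleftrightarrow> bounded (range u)) \<and>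
     (subdiff R xdag \<inter> range (adjoint A) \<noteq> {} \<or>
      argmin_set (dual_objective R A ybar) \<noteq> {} \<or>
      bounded (range u) \<longrightarrow>
        (\<exists>ustar\<in>argmin_set (dual_objective R A ybar). weakly_tendsto u ustar) \<and>
        (x \<longlonglongrightarrow> xdag \<and>
         (\<lambda>n. norm (x n - xdag)) \<in> o(\<lambda>n. real n powr (- 1 / 2))) \<and>
        (\<forall>udag\<in>argmin_set (dual_objective R A ybar). \<forall>N.
           norm udag * lam N \<in> interior (edom (conj_fun mbar)) \<longrightarrow>
           (\<exists>C\<ge>0.
              ereal (C\<^sup>2) = ereal (1 / (\<tau> * \<sigma>\<^sub>R) * (norm (u N - udag))\<^sup>2) +
                (\<Sum>k. ereal (2 / (\<sigma>\<^sub>R * lam (N + k))) *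
                      conj_fun mbar (norm udag * lam (N + k))) \<and>
              (\<forall>n>N. norm (x n - xdag) \<le> C / sqrt (real n - real N)))))"
proof -
  define X where "X v = grad (conj_fun R) (- adjoint A v)" for v
  have D0: "D ybar ybar = 0" using AD1(2) by blast
  note adj = adjoint_inner[OF A] adjoint_uminus[OF A]

  \<comment> \<open>$R$ and $\psi$ are brought into the form to which the smoothness of conjugates applies.\<close>
  define JR where "JR z = R z - ereal (\<sigma>\<^sub>R / 2 * (norm z)\<^sup>2)" for z
  have JR: "JR \<in> Gamma0" using AR1 by (simp add: strongly_convex_def JR_def[abs_def])
  have R_JR: "R z = JR z + ereal (\<sigma>\<^sub>R / 2 * (norm z)\<^sup>2)" for z by (cases "R z") (auto simp: JR_def)
  obtain s where s: "\<And>v. conj_fun R v = ereal (s v)"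
    and RX: "\<And>v. R (grad (conj_fun R) v) = ereal (grad (conj_fun R) v \<bullet> v - s v)"
    and R_growth: "\<And>v z. ereal (z \<bullet> v - s v + \<sigma>\<^sub>R / 2 * (norm (z - grad (conj_fun R) v))\<^sup>2) \<le> R z"
    and s_low: "\<And>v v'. s v + grad (conj_fun R) v \<bullet> (v' - v) \<le> s v'"
    and s_up: "\<And>v v'. s v' \<le> s v + grad (conj_fun R) v \<bullet> (v' - v) + (norm (v' - v))\<^sup>2 / (2 * \<sigma>\<^sub>R)"
    by (rule conj_fun_strongly_convex_smooth[OF JR AR1(1) R_JR]) (rule that)
  obtain J where J: "J \<in> Gamma0" "\<psi> ybar = (\<lambda>v. J v + ereal (\<sigma>\<^sub>\<psi> / 2 * (norm v)\<^sup>2))"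
    using AD2(4) by blast
  have \<psi>_J: "\<psi> ybar v = J v + ereal (\<sigma>\<^sub>\<psi> / 2 * (norm v)\<^sup>2)" for v by (simp add: J(2))
  obtain \<Psi> where \<Psi>: "\<And>v. conj_fun (\<psi> ybar) v = ereal (\<Psi> v)"
    and \<psi>X: "\<And>v. \<psi> ybar (grad (conj_fun (\<psi> ybar)) v) = ereal (grad (conj_fun (\<psi> ybar)) v \<bullet> v - \<Psi> v)"
    and \<Psi>_low: "\<And>v v'. \<Psi> v + grad (conj_fun (\<psi> ybar)) v \<bullet> (v' - v) \<le> \<Psi> v'"
    and \<Psi>_up: "\<And>v v'. \<Psi> v' \<le> \<Psi> v + grad (conj_fun (\<psi> ybar)) v \<bullet> (v' - v) + (norm (v' - v))\<^sup>2 / (2 * \<sigma>\<^sub>\<psi>)"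
    by (rule conj_fun_strongly_convex_smooth[OF J(1) AD2(1) \<psi>_J]) (rule that)

  \<comment> \<open>The dual objective is finite everywhere: $d$ is its real version, $h$ the part that depends on $R$, and $S$ the set of its minimisers.\<close>
  define h where "h v = s (- adjoint A v)" for v
  define d where "d v = h v + ybar \<bullet> v" for v
  define S where "S = argmin_set (dual_objective R A ybar)"
  have dual: "dual_objective R A ybar v = ereal (d v)" for v
    by (simp add: dual_objective_def s d_def h_def)
  have S: "z \<in> S \<longleftrightarrow> (\<forall>v. d z \<le> d v)" for z
    by (simp add: S_def argmin_set_def is_arg_min_def dual not_less)
  define M where "M = (onorm A)\<^sup>2 / \<sigma>\<^sub>R"
  have M: "0 \<le> M" using AR1(1) by (simp add: M_def)
  have h_low: "h v + - A (X v) \<bullet> (z - v) \<le> h z" for v z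
    using s_low[of "- adjoint A v" "- adjoint A z"]
    by (simp add: h_def X_def inner_diff_right adj algebra_simps)
  have h_up: "h z \<le> h v + - A (X v) \<bullet> (z - v) + M / 2 * (norm (z - v))\<^sup>2" for v z
  proof -
    have "norm (- adjoint A z - - adjoint A v) \<le> onorm A * norm (z - v)"
      using norm_adjoint_diff_le[OF A, of v z] by (simp add: norm_minus_commute)
    then have "(norm (- adjoint A z - - adjoint A v))\<^sup>2 \<le> (onorm A * norm (z - v))\<^sup>2"
      by (rule power_mono) simp
    then have "(norm (- adjoint A z - - adjoint A v))\<^sup>2 / (2 * \<sigma>\<^sub>R) \<le> (onorm A * norm (z - v))\<^sup>2 / (2 * \<sigma>\<^sub>R)"
      using AR1(1) by (intro divide_right_mono) auto
    also have "\<dots> = M / 2 * (norm (z - v))\<^sup>2" by (simp add: M_def power_mult_distrib)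
    finally show ?thesis using s_up[of "- adjoint A z" "- adjoint A v"]
      by (simp add: h_def X_def inner_diff_right adj algebra_simps)
  qed
  have d_subgrad: "d v + (z - v) \<bullet> (ybar - A (X v)) \<le> d z" for v z
    using h_low[of v z] by (simp add: d_def inner_simps inner_commute)

  \<comment> \<open>The feasible set of the primal problem is an affine subspace.\<close>
  have feas: "argmin_set (\<lambda>x'. D (A x') ybar) = {z. A z = ybar}"
  proof -
    have "(\<forall>y. D (A z) ybar \<le> D (A y) ybar) \<longleftrightarrow> A z = ybar" for z
      using AD1 xbar by (metis order_antisym)
    then show ?thesis unfolding argmin_set_def is_arg_min_def by (simp add: not_less)
  qed
  have xdag_feas: "A xdag = ybar" and xdag_min: "\<And>z. A z = ybar \<Longrightarrow> R xdag \<le> R z"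
    using xdag unfolding is_arg_min_def feas by (auto simp: not_less)
  obtain r where r: "R xdag = ereal r"
  proof -
    have "R xdag < \<infinity>" using xdag_min[OF xbar] AR2 by (auto simp: edom_def)
    moreover have "R xdag \<noteq> -\<infinity>" using AR1(2) Gamma0_D(1) by (auto simp: strongly_convex_def)
    ultimately show ?thesis using that by (cases "R xdag") auto
  qed

  \<comment> \<open>At a dual solution the gradient of $d$ vanishes, so the associated primal point is feasible; growth of $R$ around it identifies it with the primal solution.\<close>
  have kkt: "X z = xdag" "r = - d z" if z: "z \<in> S" for z
  proof -
    have "ybar - A (X z) = 0"
    proof (rule minimizer_gradient_zero[OF _ M])
      show "d z \<le> d y" for y using z S by simp
      show "d y \<le> d z + (ybar - A (X z)) \<bullet> (y - z) + M / 2 * (norm (y - z))\<^sup>2" for y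
        using h_up[of y z] by (simp add: d_def inner_simps)
    qed
    then have AX: "A (X z) = ybar" by simp
    have val: "y \<bullet> (- adjoint A z) - h z = - d z" if "A y = ybar" for y
      using that by (simp add: d_def flip: adj)
    have "R (X z) = ereal (- d z)" using RX[of "- adjoint A z"] val[OF AX] by (simp add: X_def h_def)
    moreover have "ereal (- d z + \<sigma>\<^sub>R / 2 * (norm (xdag - X z))\<^sup>2) \<le> ereal r"
      using R_growth[of xdag "- adjoint A z"] val[OF xdag_feas] r by (simp add: X_def h_def)
    ultimately have le: "r \<le> - d z" "- d z + \<sigma>\<^sub>R / 2 * (norm (xdag - X z))\<^sup>2 \<le> r"
      using xdag_min[OF AX] r by simp_all
    then have "\<sigma>\<^sub>R / 2 * (norm (xdag - X z))\<^sup>2 \<le> 0" by linarith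
    then have "(norm (xdag - X z))\<^sup>2 \<le> 0" using AR1(1) by (simp add: mult_le_0_iff)
    then show "X z = xdag" by simp
    then show "r = - d z" using le by simp
  qed

  have ii_i: "subdiff R xdag \<inter> range (adjoint A) \<noteq> {}" if ne: "S \<noteq> {}"
  proof -
    obtain z where z: "z \<in> S" using ne by blast
    have "R xdag + ereal ((y - xdag) \<bullet> adjoint A (- z)) \<le> R y" for y
    proof -
      have "xdag \<bullet> adjoint A z = ybar \<bullet> z" by (simp add: xdag_feas flip: adj(1))
      moreover have "0 \<le> \<sigma>\<^sub>R / 2 * (norm (y - X z))\<^sup>2" using AR1(1) by simp
      ultimately have "r + (y - xdag) \<bullet> adjoint A (- z)
          \<le> y \<bullet> (- adjoint A z) - h z + \<sigma>\<^sub>R / 2 * (norm (y - X z))\<^sup>2"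
        using kkt(2)[OF z] by (simp add: d_def adj(2) inner_diff_left)
      then have "R xdag + ereal ((y - xdag) \<bullet> adjoint A (- z))
          \<le> ereal (y \<bullet> (- adjoint A z) - h z + \<sigma>\<^sub>R / 2 * (norm (y - X z))\<^sup>2)"
        by (simp only: r plus_ereal.simps ereal_less_eq)
      also have "\<dots> \<le> R y" using R_growth[of y "- adjoint A z"] by (simp only: X_def h_def)
      finally show ?thesis .
    qed
    then show ?thesis by (auto simp: subdiff_def)
  qed
  have i_ii: "S \<noteq> {}" if ne: "subdiff R xdag \<inter> range (adjoint A) \<noteq> {}"
  proof -
    obtain v where v: "adjoint A v \<in> subdiff R xdag" using ne by blast
    have "d (- v) = - r"
      using subdiff_conj_fun[OF v r]
      by (simp add: s d_def h_def adj(2) xdag_feas flip: adj(1))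
    moreover have "- r \<le> d y" for y
      using fenchel_young[of xdag "- adjoint A y" R] r
      by (simp add: s d_def h_def xdag_feas flip: adj(1))
    ultimately have "- v \<in> S" by (simp add: S)
    then show ?thesis by blast
  qed

  obtain \<epsilon> \<gamma> where wc: "0 < \<epsilon>" "0 < \<gamma>" "\<And>t. t \<in> {-\<epsilon><..<\<epsilon>} \<Longrightarrow> ereal (\<gamma> / p * \<bar>t\<bar> powr p) \<le> mbar t"
    and cm: "cond_modulus (\<lambda>v. D v ybar) mbar"
    using AD3(3) unfolding well_conditioned_def by metis
  have m: "mbar \<in> Gamma0" "\<And>t. 0 \<le> mbar t" "\<And>t. mbar (- t) = mbar t"
    using cm by (auto simp: cond_modulus_def)
  have m_le: "mbar (norm (v - ybar)) \<le> D v ybar" for v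
  proof -
    obtain x0 where x0: "argmin_set (\<lambda>v. D v ybar) = {x0}"
      and le: "\<And>v. mbar (norm (v - x0)) \<le> D v ybar - D x0 ybar"
      using cm unfolding cond_modulus_def by metis
    have "ybar \<in> argmin_set (\<lambda>v. D v ybar)"
      unfolding argmin_set_def is_arg_min_def by (simp add: not_less D0 AD1(1))
    then have "x0 = ybar" using x0 by simp
    then show ?thesis using le[of v] D0 by simp
  qed
  have m0: "mbar 0 = 0" using m_le[of ybar] m(2)[of 0] D0 by simp
  \<comment> \<open>$E_z(n)$ bounds the gap $d_n(z) - d(z)$ wherever the conjugate modulus is finite.\<close>
  define E where "E z n = real_of_ereal (conj_fun mbar (norm z * lam n)) / lam n" for z :: 'b and n
  have m_nonneg: "0 \<le> conj_fun mbar t" for t by (rule conj_fun_nonneg[of mbar, OF m0])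
  have E_nonneg: "0 \<le> E z n" for z n
    using m_nonneg lam(1)[of n] by (simp add: E_def real_of_ereal_pos)
  have E_ev: "eventually (\<lambda>n. conj_fun mbar (norm z * lam n) < \<infinity>) sequentially"
    and E_summable: "summable (E z)" for z
    using conj_modulus_summable[OF m(1,2) m0 AD3(2) wc lam(1,3) lam_summable norm_ge_zero[of z]]
    by (simp_all add: E_def[abs_def])
  \<comment> \<open>Once the error term is finite it stays finite, as $\lambda_n$ decreases.\<close>
  have fin_mono: "conj_fun mbar (norm z * lam n) < \<infinity>"
    if "conj_fun mbar (norm z * lam N) < \<infinity>" "N \<le> n" for z N n
  proof -
    have "conj_fun mbar (norm z * lam n) \<le> conj_fun mbar (norm z * lam N)"
      using decseqD[OF lam(2) that(2)] lam(1)[of n]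
      by (intro conj_fun_even_mono[of mbar, OF m(3)] mult_left_mono) (auto simp: less_imp_le)
    then show ?thesis using that(1) by (rule le_less_trans)
  qed

  \<comment> \<open>$G$ is the conjugate $D^*$; unlike $\Psi$ it may take the value $\infty$.\<close>
  define G where "G v = conj_fun (\<lambda>v. D v ybar) v" for v
  have G: "G v = ereal (\<Psi> v) + conj_fun (\<phi> ybar) v" for v
  proof -
    obtain q \<beta> where \<beta>: "\<phi> ybar q = ereal \<beta>" using Gamma0_D(2)[OF AD2(3)] by blast
    show ?thesis
      unfolding G_def AD2(2) \<Psi>[symmetric]
    proof (rule conj_fun_inf_conv)
      show "\<psi> ybar y \<noteq> -\<infinity>" for y using Gamma0_D(1)[OF J(1), of y] \<psi>_J[of y] by (cases "J y") auto
      show "\<phi> ybar y \<noteq> -\<infinity>" for y by (rule Gamma0_D(1)[OF AD2(3)])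
      show "\<phi> ybar q = ereal \<beta>" by (fact \<beta>)
      show "\<psi> ybar (grad (conj_fun (\<psi> ybar)) v) = ereal (grad (conj_fun (\<psi> ybar)) v \<bullet> v - \<Psi> v)"
        by (fact \<psi>X)
    qed (simp add: \<Psi>)
  qed
  have G_low: "ereal (ybar \<bullet> v) \<le> G v" for v
    using fenchel_young[of ybar v "\<lambda>v. D v ybar"] D0 by (simp add: G_def flip: zero_ereal_def)
  have G_up: "G (lam n *\<^sub>R z) \<le> ereal (lam n * (ybar \<bullet> z + E z n))"
    if "conj_fun mbar (norm z * lam n) < \<infinity>" for z n
  proof -
    have "norm (lam n *\<^sub>R z) = norm z * lam n" using lam(1)[of n] by (simp add: less_imp_le)
    then have "G (lam n *\<^sub>R z) \<le> ereal (ybar \<bullet> (lam n *\<^sub>R z)) + conj_fun mbar (norm z * lam n)"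
      using conj_fun_le_modulus[of mbar ybar "\<lambda>v. D v ybar", OF m_le, of "lam n *\<^sub>R z"]
      by (simp only: G_def)
    also have "\<dots> = ereal (lam n * (ybar \<bullet> z + E z n))"
      using that m_nonneg[of "norm z * lam n"] lam(1)[of n]
      by (cases "conj_fun mbar (norm z * lam n)") (auto simp: E_def algebra_simps)
    finally show ?thesis .
  qed
  \<comment> \<open>Monotonicity of $\lambda \mapsto \lambda^{-1}D^*(\lambda z)$, which holds because $D \ge 0$.\<close>
  have G_scale: "G (lam (Suc n) *\<^sub>R z) \<le> ereal (lam (Suc n) * a)" if le: "G (lam n *\<^sub>R z) \<le> ereal (lam n * a)" for z n a
    unfolding G_def
  proof (rule conj_fun_leI)
    fix v
    have "ereal (v \<bullet> (lam n *\<^sub>R z)) - D v ybar \<le> ereal (lam n * a)"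
      using fenchel_young[of v "lam n *\<^sub>R z" "\<lambda>v. D v ybar"] le unfolding G_def by (rule order_trans)
    show "ereal (v \<bullet> (lam (Suc n) *\<^sub>R z)) - D v ybar \<le> ereal (lam (Suc n) * a)"
    proof (cases "D v ybar")
      case (real t)
      have "lam n * (v \<bullet> z - a) \<le> t"
        using \<open>ereal (v \<bullet> (lam n *\<^sub>R z)) - D v ybar \<le> ereal (lam n * a)\<close> real by (simp add: algebra_simps)
      then have "v \<bullet> z - a \<le> t / lam n" using lam(1)[of n] by (simp add: field_simps)
      also have "\<dots> \<le> t / lam (Suc n)"
        using lam(1)[of n] lam(1)[of "Suc n"] decseqD[OF lam(2), of n "Suc n"] AD1(1)[of v ybar] real
        by (intro divide_left_mono) auto
      finally have "lam (Suc n) * (v \<bullet> z - a) \<le> t" using lam(1)[of "Suc n"] by (simp add: field_simps)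
      then show ?thesis using real by (simp add: algebra_simps)
    qed (use AD1(1)[of v ybar] in auto)
  qed

  \<comment> \<open>The forward-backward inequality for $d_n$, for every real upper bound $a$ of $\lambda_n^{-1}D^*(\lambda_n z)$; the number $b$ is its value at $u_{n+1}$.\<close>
  have step: "\<exists>b. G (lam n *\<^sub>R u (Suc n)) = ereal (lam n * b) \<and>
    (\<forall>z a. G (lam n *\<^sub>R z) \<le> ereal (lam n * a) \<longrightarrow>
      h (u (Suc n)) + b + (norm (u (Suc n) - z))\<^sup>2 / (2 * \<tau>) \<le> h z + a + (norm (u n - z))\<^sup>2 / (2 * \<tau>))" for n
  proof -
    have "M + lam n / \<sigma>\<^sub>\<psi> \<le> L"
      using decseqD[OF lam(2), of 0 n] AD2(1) by (simp add: L M_def divide_right_mono)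
    moreover have "0 < L" using M lam(1)[of 0] AD2(1) by (simp add: L flip: M_def) (simp add: add_nonneg_pos)
    moreover have "\<tau> * (M + lam n / \<sigma>\<^sub>\<psi>) \<le> 1 / L * L"
      using calculation tau M lam(1)[of n] AD2(1) by (intro mult_mono) auto
    ultimately have \<tau>L: "\<tau> * (M + lam n / \<sigma>\<^sub>\<psi>) \<le> 1" by simp
    have w: "w (Suc n) = u n - \<tau> *\<^sub>R (- A (X (u n))) - \<tau> *\<^sub>R grad (conj_fun (\<psi> ybar)) (lam n *\<^sub>R u n)"
      unfolding w_step x_step X_def by simp
    show ?thesis
      unfolding G
      by (rule dual_diagonal_step[OF lam(1) AD2(1) AD2(3) tau(1) \<tau>L h_low h_up \<Psi>_low \<Psi>_up w u_step]) blast
  qed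
  then obtain b where Gb: "\<And>n. G (lam n *\<^sub>R u (Suc n)) = ereal (lam n * b n)"
    and Gstep: "\<And>n z a. G (lam n *\<^sub>R z) \<le> ereal (lam n * a) \<Longrightarrow>
      h (u (Suc n)) + b n + (norm (u (Suc n) - z))\<^sup>2 / (2 * \<tau>) \<le> h z + a + (norm (u n - z))\<^sup>2 / (2 * \<tau>)"
    by metis
  define val where "val n = h (u (Suc n)) + b n" for n
  have d_val: "d (u (Suc n)) \<le> val n" for n
  proof -
    have "ereal (ybar \<bullet> (lam n *\<^sub>R u (Suc n))) \<le> ereal (lam n * b n)" using G_low Gb by metis
    then show ?thesis using lam(1)[of n] by (simp add: val_def d_def)
  qed
  \<comment> \<open>The descent inequality at the current iterate $z = u_{n+1}$, passing from $d_n$ to $d_{n+1}$.\<close>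
  have val_dec: "decseq val"
  proof (rule decseq_SucI)
    fix n
    have "h (u (Suc (Suc n))) + b (Suc n) + (norm (u (Suc (Suc n)) - u (Suc n)))\<^sup>2 / (2 * \<tau>)
        \<le> h (u (Suc n)) + b n + (norm (u (Suc n) - u (Suc n)))\<^sup>2 / (2 * \<tau>)"
      by (rule Gstep, rule G_scale) (simp add: Gb)
    moreover have "0 \<le> (norm (u (Suc (Suc n)) - u (Suc n)))\<^sup>2 / (2 * \<tau>)" using tau(1) by simp
    ultimately show "val (Suc n) \<le> val n" by (simp add: val_def)
  qed
  \<comment> \<open>From here on only the descent inequality, the monotonicity of the values and $d(u_{n+1}) \le v_n$ enter the analysis of the dual iterates.\<close>
  define a where "a z n = (norm (u n - z))\<^sup>2 / (2 * \<tau>)" for z n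
  have a_nonneg: "0 \<le> a z n" for z n using tau(1) by (simp add: a_def)
  have descent: "val n + a z (Suc n) \<le> d z + a z n + E z n"
    if "conj_fun mbar (norm z * lam n) < \<infinity>" for z n
    using Gstep[OF G_up[OF that]] by (simp add: val_def a_def d_def)
  have shift: "decseq (\<lambda>k. val (N + k))" "summable (\<lambda>k. E z (N + k))" for N z
    using val_dec E_summable[of z] by (auto simp: decseq_def summable_iff_shift add.commute)
  have rate: "(\<Sum>k<n. val (N + k) - d z) \<le> a z N + (\<Sum>k. E z (N + k))"
      "real (Suc n) * (val (N + n) - d z) \<le> a z N + (\<Sum>k. E z (N + k))"
    if "conj_fun mbar (norm z * lam N) < \<infinity>" for z N n
    using descent_rate[of "\<lambda>k. val (N + k)" "\<lambda>k. a z (N + k)" "\<lambda>k. E z (N + k)" "d z" n,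
      OF shift(1) a_nonneg E_nonneg shift(2)] descent fin_mono[OF that] by auto
  have val_lim: "eventually (\<lambda>n. val n \<le> d z + e) sequentially" if e: "0 < e" for z e
  proof -
    obtain N where N: "conj_fun mbar (norm z * lam N) < \<infinity>"
      using E_ev[of z] by (auto simp: eventually_sequentially)
    define K where "K = a z N + (\<Sum>k. E z (N + k))"
    obtain k where "K < real k * e" using reals_Archimedean3[OF e] by blast
    then have k: "K < real (Suc k) * e" using e by (simp add: distrib_right)
    have "real (Suc k) * (val (N + k) - d z) < real (Suc k) * e"
      using rate(2)[OF N, of k] k unfolding K_def by (rule le_less_trans)
    then have "val (N + k) - d z < e" by (rule mult_left_less_imp_less) simp
    then have "val (N + k) \<le> d z + e" by simp
    then show ?thesis unfolding eventually_sequentially using decseqD[OF val_dec] order_trans by blast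
  qed
  have d_lim: "eventually (\<lambda>n. d (u n) \<le> d z + e) sequentially" if "0 < e" for z e
  proof -
    have "eventually (\<lambda>n. d (u (Suc n)) \<le> d z + e) sequentially"
      using val_lim[OF that] by (rule eventually_mono) (use d_val order_trans in blast)
    then show ?thesis by (subst (asm) eventually_sequentially_Suc)
  qed
  \<comment> \<open>The values $d(u_n)$ are eventually below $d(z)+e$ for every $z$ and $e>0$, hence $d(v) \le d(z)$.\<close>
  have tail_S: "v \<in> S" if "tail_hull_point u v" for v
    unfolding S using tail_hull_point_value_le[OF that d_subgrad d_lim] by blast
  have iii_ii: "S \<noteq> {}" if "bounded (range u)"
    using tail_hull_point_exists[OF that] tail_S by blast

  have fejer: "convergent (\<lambda>n. (norm (u n - z))\<^sup>2)" if "z \<in> S" for z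
  proof -
    obtain N where N: "conj_fun mbar (norm z * lam N) < \<infinity>"
      using E_ev[of z] by (auto simp: eventually_sequentially)
    have "convergent (\<lambda>k. a z (N + k))"
    proof (rule quasi_fejer_convergent[OF a_nonneg E_nonneg shift(2)])
      fix k
      have "d z \<le> val (N + k)" using that S d_val order_trans by blast
      then show "a z (N + Suc k) \<le> a z (N + k) + E z (N + k)"
        using descent[OF fin_mono[OF N, of "N + k"]] by simp
    qed
    then have "convergent (\<lambda>n. a z n)" by (simp add: add.commute convergent_ignore_initial_segment)
    then have "convergent (\<lambda>n. 2 * \<tau> * a z n)" by (intro convergent_mult convergent_const)
    then show ?thesis using tau(1) by (simp add: a_def)
  qed
  have ii_iii: "bounded (range u)" if ne: "S \<noteq> {}"
  proof -
    obtain z where "z \<in> S" using ne by blast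
    then obtain B where B: "\<And>n. norm ((norm (u n - z))\<^sup>2) \<le> B"
      using convergent_imp_Bseq[OF fejer] unfolding Bseq_def by blast
    have "norm (u n - z) \<le> sqrt B" for n using B[of n] by (intro real_le_rsqrt) simp
    then have "norm (u n) \<le> sqrt B + norm z" for n
      using norm_triangle_ineq[of "u n - z" z] by (smt (verit) diff_add_cancel)
    then show ?thesis by (auto simp: bounded_iff)
  qed

  \<comment> \<open>Dual values control primal distances: growth of $R$ at $x_n$, and $R(x^\dagger) = -\min d$.\<close>
  have primal: "\<sigma>\<^sub>R / 2 * (norm (x (Suc n) - xdag))\<^sup>2 \<le> val n - d z" if z: "z \<in> S" for z n
  proof -
    have "xdag \<bullet> (- adjoint A (u (Suc n))) = - (ybar \<bullet> u (Suc n))" by (simp add: xdag_feas flip: adj(1))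
    then have "- d (u (Suc n)) + \<sigma>\<^sub>R / 2 * (norm (xdag - x (Suc n)))\<^sup>2 \<le> - d z"
      using R_growth[of xdag "- adjoint A (u (Suc n))"] r kkt(2)[OF z] by (simp add: x_step d_def h_def)
    then show ?thesis using d_val[of n] by (simp add: norm_minus_commute)
  qed

  have weak: "\<exists>ustar\<in>S. weakly_tendsto u ustar" if ne: "S \<noteq> {}"
    by (rule opial[OF ii_iii[OF that] fejer tail_S])

  have strong: "x \<longlonglongrightarrow> xdag" "(\<lambda>n. norm (x n - xdag)) \<in> o(\<lambda>n. real n powr (- 1 / 2))" if ne: "S \<noteq> {}"
  proof -
    obtain z where z: "z \<in> S" using ne by blast
    obtain N where N: "conj_fun mbar (norm z * lam N) < \<infinity>"
      using E_ev[of z] by (auto simp: eventually_sequentially)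
    define c where "c n = 2 / \<sigma>\<^sub>R * (val n - d z)" for n
    have val_d: "0 \<le> val n - d z" for n using z S d_val[of n] by (smt (verit))
    have c_nonneg: "0 \<le> c n" for n using val_d AR1(1) by (simp add: c_def)
    have "summable (\<lambda>k. val (N + k) - d z)"
      by (rule summableI_nonneg_bounded[OF val_d rate(1)[OF N]])
    then have "summable (\<lambda>n. val n - d z)" by (subst (asm) add.commute) (simp add: summable_iff_shift[of "\<lambda>n. val n - d z"])
    then have c_sum: "summable c" unfolding c_def by (rule summable_mult)
    have "decseq c" unfolding c_def decseq_def
      using decseqD[OF val_dec] AR1(1) by (auto intro!: divide_right_mono)
    then have nc: "(\<lambda>n. real n * c n) \<longlonglongrightarrow> 0" by (rule decseq_summable_o[OF _ c_nonneg c_sum])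
    have "(norm (x (Suc n) - xdag))\<^sup>2 \<le> c n" for n
      using primal[OF z, of n] AR1(1) by (simp add: c_def field_simps)
    then have "(\<lambda>n. norm (x n - xdag)) \<in> o(\<lambda>n. real n powr (- 1 / 2))" "(\<lambda>n. norm (x n - xdag)) \<longlonglongrightarrow> 0"
      by (rule rate_smallo[OF nc summable_LIMSEQ_zero[OF c_sum] norm_ge_zero])+
    then show "x \<longlonglongrightarrow> xdag" "(\<lambda>n. norm (x n - xdag)) \<in> o(\<lambda>n. real n powr (- 1 / 2))"
      by (simp_all add: tendsto_norm_zero_iff LIM_zero_iff)
  qed

  have bound: "\<exists>C\<ge>0. ereal (C\<^sup>2) = ereal (1 / (\<tau> * \<sigma>\<^sub>R) * (norm (u N - z))\<^sup>2) +
        (\<Sum>k. ereal (2 / (\<sigma>\<^sub>R * lam (N + k))) * conj_fun mbar (norm z * lam (N + k))) \<and>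
      (\<forall>n>N. norm (x n - xdag) \<le> C / sqrt (real n - real N))"
    if z: "z \<in> S" and N: "norm z * lam N \<in> interior (edom (conj_fun mbar))" for z N
  proof -
    have fin: "conj_fun mbar (norm z * lam N) < \<infinity>" using subsetD[OF interior_subset N] by (simp add: edom_def)
    define K where "K = a z N + (\<Sum>k. E z (N + k))"
    have K: "0 \<le> K" unfolding K_def by (intro add_nonneg_nonneg a_nonneg suminf_nonneg shift E_nonneg)
    define C where "C = sqrt (2 / \<sigma>\<^sub>R * K)"
    have C2: "C\<^sup>2 = 2 / \<sigma>\<^sub>R * K" using K AR1(1) by (simp add: C_def)
    have "(\<lambda>k. 2 / \<sigma>\<^sub>R * E z (N + k)) sums (2 / \<sigma>\<^sub>R * (\<Sum>k. E z (N + k)))"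
      by (intro sums_mult summable_sums shift)
    then have "(\<lambda>k. ereal (2 / \<sigma>\<^sub>R * E z (N + k))) sums ereal (2 / \<sigma>\<^sub>R * (\<Sum>k. E z (N + k)))"
      by (simp only: sums_ereal)
    moreover have "ereal (2 / \<sigma>\<^sub>R * E z (N + k))
        = ereal (2 / (\<sigma>\<^sub>R * lam (N + k))) * conj_fun mbar (norm z * lam (N + k))" for k
      using fin_mono[OF fin, of "N + k"] m_nonneg[of "norm z * lam (N + k)"]
      by (cases "conj_fun mbar (norm z * lam (N + k))") (auto simp: E_def)
    ultimately have "(\<Sum>k. ereal (2 / (\<sigma>\<^sub>R * lam (N + k))) * conj_fun mbar (norm z * lam (N + k)))
        = ereal (2 / \<sigma>\<^sub>R * (\<Sum>k. E z (N + k)))" using sums_unique by force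
    moreover have "1 / (\<tau> * \<sigma>\<^sub>R) * (norm (u N - z))\<^sup>2 = 2 / \<sigma>\<^sub>R * a z N" by (simp add: a_def)
    ultimately have eq: "ereal (C\<^sup>2) = ereal (1 / (\<tau> * \<sigma>\<^sub>R) * (norm (u N - z))\<^sup>2) +
        (\<Sum>k. ereal (2 / (\<sigma>\<^sub>R * lam (N + k))) * conj_fun mbar (norm z * lam (N + k)))"
      by (simp only: C2 K_def distrib_left plus_ereal.simps)
    have "norm (x n - xdag) \<le> C / sqrt (real n - real N)" if n: "N < n" for n
    proof -
      obtain k where k: "n = Suc (N + k)" using n less_imp_Suc_add by blast
      have "real (Suc k) * (\<sigma>\<^sub>R / 2 * (norm (x n - xdag))\<^sup>2) \<le> real (Suc k) * (val (N + k) - d z)"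
        unfolding k by (intro mult_left_mono primal[OF z]) simp
      also have "\<dots> \<le> K" using rate(2)[OF fin, of k] by (simp add: K_def)
      finally have "(norm (x n - xdag))\<^sup>2 \<le> (2 / \<sigma>\<^sub>R * K) / real (Suc k)"
        using AR1(1) by (simp add: field_simps del: of_nat_Suc)
      also have "\<dots> = (C / sqrt (real (Suc k)))\<^sup>2" by (simp add: power_divide C2)
      finally have "norm (x n - xdag) \<le> C / sqrt (real (Suc k))"
        by (rule power2_le_imp_le) (use K AR1(1) in \<open>simp add: C_def\<close>)
      then show ?thesis by (simp add: k add.commute)
    qed
    then show ?thesis using eq K AR1(1) by (intro exI[of _ C]) (auto simp: C_def)
  qed

  show ?thesis
    unfolding S_def[symmetric]
    using i_ii ii_i ii_iii iii_ii weak strong bound by blast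
qed

end
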